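(* Let $d$ be a positive integer and suppose $\Omega\subset U_d$ contains infinitely many roots of unity whose orders are prime powers. If $f,g\in\hat\Lambda_d$ satisfy $\mathrm{ev}_\xi(f)=\mathrm{ev}_\xi(g)$ for every $\xi\in\Omega$, then $f=g$. In other words, the map $\mathrm{ev}_\Omega:\hat\Lambda_d\to\prod_{\xi\in\Omega}\mathbb C$, $\mathrm{ev}_\Omega(f)=(\mathrm{ev}_\xi(f))_{\xi\in\Omega}$, is injective.
   Context: For a positive integer $d$ let $\mathbb N_d$ be the set of positive integers co-prime with $d$, $A_d=\mathbb Z[\frac1d][q^{\pm1/d}]$, $\Phi_s$ the $s$-th cyclotomic polynomial, $\Lambda_d=A_d\bigl[\frac1{\Phi_s(q^{1/d})},\ s\notin\mathbb N_d\bigr]\subset\mathbb Q(q^{1/d})$, $(q;q)_n=\prod_{i=1}^n(1-q^i)$, and $\hat\Lambda_d=\varprojlim_n\Lambda_d/((q;q)_n)$. $U_d$ is the set of complex roots of unity whose orders are odd and co-prime with $d$. Evaluation: for $\xi\in U_d$ of order $r$, let $b$ be the integer (unique mod $r$) with $(\xi^b)^d=\xi$. For $f\in\Lambda_d$ put $\mathrm{ev}_\xi(f)=f|_{q^{1/d}=\xi^b}$. Since $\mathrm{ev}_\xi((q;q)_n)=0$ for $n\ge r$, this extends to a ring homomorphism $\mathrm{ev}_\xi:\hat\Lambda_d\to\mathbb C$. *)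

theory Defs
  imports
    "HOL-Computational_Algebra.Computational_Algebra"
    "HOL-Computational_Algebra.Field_as_Ring"
    "HOL-Algebra.Algebra"
    "HOL-Algebra.Algebraic_Closure_Type"
    "HOL-Number_Theory.Prime_Powers"
    "HOL-Analysis.Analysis"
begin

section \<open>Roots of unity and cyclotomic polynomials\<close>

definition roots_of_unity :: "complex set" where
  "roots_of_unity = {\<xi>. \<exists>n>0. \<xi> ^ n = 1}"

definition root_order :: "complex \<Rightarrow> nat" where
  "root_order \<xi> = (LEAST n. 0 < n \<and> \<xi> ^ n = 1)"

abbreviation cpoly :: "rat poly \<Rightarrow> complex poly" where
  "cpoly \<equiv> map_poly of_rat"

definition cyclotomic :: "nat \<Rightarrow> rat poly" where
  "cyclotomic s =
     (THE p. cpoly p = (\<Prod>\<zeta> \<in> {\<zeta> \<in> roots_of_unity. root_order \<zeta> = s}. [:- \<zeta>, 1:]))"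


section \<open>The ring Lambda and its completion\<close>

definition coprime_pos :: "nat \<Rightarrow> nat set" where
  "coprime_pos d = {n. 0 < n \<and> coprime n d}"

text \<open>
  The field of rational functions in one variable over the rationals is
  \<^typ>\<open>rat poly fract\<close>. The indeterminate \<open>qroot\<close> stands for the \<open>d\<close>-th root of \<open>q\<close>,
  so that \<open>q\<close> itself is \<open>qroot ^ d\<close>.
\<close>

abbreviation rat_functions :: "rat poly fract ring" where
  "rat_functions \<equiv> ring_of_type_algebra"

definition qroot :: "rat poly fract" where
  "qroot = to_fract [:0, 1:]"

definition A_set :: "nat \<Rightarrow> rat poly fract set" where
  "A_set d = generate_ring rat_functions {1 / of_nat d, qroot, 1 / qroot}"

definition Lambda :: "nat \<Rightarrow> rat poly fract ring" where
  "Lambda d = rat_functions \<lparr>carrier := generate_ring rat_functions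
     (A_set d \<union> {1 / to_fract (cyclotomic s) | s. 0 < s \<and> s \<notin> coprime_pos d})\<rparr>"

definition qfact :: "nat \<Rightarrow> nat \<Rightarrow> rat poly fract" where
  "qfact d n = (\<Prod>i = 1..n. 1 - (qroot ^ d) ^ i)"

definition qideal :: "nat \<Rightarrow> nat \<Rightarrow> rat poly fract set" where
  "qideal d n = PIdl\<^bsub>Lambda d\<^esub> (qfact d n)"

text \<open>
  Elements of the inverse limit are compatible families of cosets. For \<open>m \<le> n\<close> the transition
  map \<open>a + I\<^sub>n \<mapsto> a + I\<^sub>m\<close> sends a coset \<open>C\<close> to the sum of sets \<open>C + I\<^sub>m\<close>.
\<close>

definition Lambda_hat :: "nat \<Rightarrow> (nat \<Rightarrow> rat poly fract set) ring" where
  "Lambda_hat d =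
     \<lparr>carrier = {f. (\<forall>n. f n \<in> carrier (Lambda d Quot qideal d n)) \<and>
                    (\<forall>m n. m \<le> n \<longrightarrow> f n <+>\<^bsub>Lambda d\<^esub> qideal d m = f m)},
      monoid.mult = (\<lambda>f g n. f n \<otimes>\<^bsub>Lambda d Quot qideal d n\<^esub> g n),
      one = (\<lambda>n. \<one>\<^bsub>Lambda d Quot qideal d n\<^esub>),
      ring.zero = (\<lambda>n. \<zero>\<^bsub>Lambda d Quot qideal d n\<^esub>),
      add = (\<lambda>f g n. f n \<oplus>\<^bsub>Lambda d Quot qideal d n\<^esub> g n)\<rparr>"


section \<open>Evaluation at roots of unity\<close>

definition U_set :: "nat \<Rightarrow> complex set" where
  "U_set d = {\<xi> \<in> roots_of_unity. odd (root_order \<xi>) \<and> coprime (root_order \<xi>) d}"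

text \<open>
  Value of a rational function at \<open>z\<close>, computed from its reduced fraction; meaningful whenever
  the reduced denominator does not vanish at \<open>z\<close>.
\<close>

definition eval_fract :: "complex \<Rightarrow> rat poly fract \<Rightarrow> complex" where
  "eval_fract z f =
     poly (cpoly (fst (quot_of_fract f))) z / poly (cpoly (snd (quot_of_fract f))) z"

definition root_exponent :: "nat \<Rightarrow> complex \<Rightarrow> int" where
  "root_exponent d \<xi> = (SOME b. (\<xi> powi b) ^ d = \<xi>)"

definition ev :: "nat \<Rightarrow> complex \<Rightarrow> rat poly fract \<Rightarrow> complex" where
  "ev d \<xi> f = eval_fract (\<xi> powi root_exponent d \<xi>) f"

text \<open>
  On the completion, evaluation is the common value of \<open>ev\<close> on all representatives of the
  components of index at least the order of \<open>\<xi>\<close>.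
\<close>

definition ev_hat :: "nat \<Rightarrow> complex \<Rightarrow> (nat \<Rightarrow> rat poly fract set) \<Rightarrow> complex" where
  "ev_hat d \<xi> f = (THE c. \<forall>n \<ge> root_order \<xi>. \<forall>a \<in> f n. ev d \<xi> a = c)"

definition ev_family ::
  "nat \<Rightarrow> complex set \<Rightarrow> (nat \<Rightarrow> rat poly fract set) \<Rightarrow> complex \<Rightarrow> complex" where
  "ev_family d \<Omega> f = (\<lambda>\<xi>\<in>\<Omega>. ev_hat d \<xi> f)"

end

(* Write x for the d-th root of q and F_t for x^t - 1.  Up to units of Lambda_d, (q;q)_n is a product
   of polynomials F_t with t coprime to d, so a coherent family whose members are divisible by every
   power of every such F_t is zero.

   Vanishing to infinite order at 1: suppose (x-1)^m divides the family.  After removing this factor, a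
   numerator A vanishes at K roots of unity of distinct prime power orders, hence is divisible in Z[x]
   by their minimal polynomials.  The minimal polynomial of a root of order p^e takes a value divisible
   by p at 1, because (x-1)^(p^e) and F_(p^e) agree modulo p.  Thus A(1), which up to powers of d does
   not depend on the member of the family, has divisors coprime to d of size at least 2^K for every K,
   so A(1) = 0.

   Vanishing to infinite order then spreads from F_n to F_(np) for primes p not dividing d: modulo
   F_(np) high powers of F_n become divisible by high powers of p, while Z[x]/(F_(np)) is p-adically
   separated. *)

theory Submission
  imports Defs "HOL-Number_Theory.Cong"
begin

hide_const (open) Divisibility.prime Henstock_Kurzweil_Integration.content

section \<open>Integer polynomials and monic division\<close>

text \<open>A root of order r can be used only at levels N >= r, so a single member of the family
  sees finitely many of the given roots, while forcing A(1) = 0 takes arbitrarily many. The levels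
  are therefore compared: (q;q)_N is divisible by F_t^(m+1) as soon as N >= t(m+1), so once F_t^m
  has been removed the quotients at levels N and M >= N agree modulo F_t, and M may be chosen as
  large as needed. The same comparison supplies the high powers of F_n in the passage to F_(np).
  Sizes of divisors and p-adic limits make sense only for integer coefficients, hence elements of
  Lambda_d are kept as fractions with numerator and denominator in Z[x]. Such denominators are
  invertible modulo F_t only up to a power of d; this is harmless because every prime involved is
  coprime to d. Prime power orders matter at 1: a cyclotomic polynomial whose index exceeds 1 and is
  not a prime power takes the value 1 there and yields no divisor.\<close>

lemma of_int_poly_add [simp]:
  "map_poly of_int (p + q) = (map_poly of_int p + map_poly of_int q :: 'a::ring_1 poly)"
  by (intro poly_eqI) (simp add: coeff_map_poly)

lemma of_int_poly_diff [simp]: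
  "map_poly of_int (p - q) = (map_poly of_int p - map_poly of_int q :: 'a::ring_1 poly)"
  by (intro poly_eqI) (simp add: coeff_map_poly)

lemma of_int_poly_mult [simp]:
  "map_poly of_int (p * q) = (map_poly of_int p * map_poly of_int q :: 'a::comm_ring_1 poly)"
  by (intro poly_eqI) (simp add: coeff_map_poly coeff_mult)

lemma of_int_poly_power [simp]:
  "map_poly of_int (p ^ n) = (map_poly of_int p ^ n :: 'a::comm_ring_1 poly)"
  by (induction n) simp_all

lemma of_int_poly_prod [simp]:
  "map_poly of_int (prod f A) = (\<Prod>x\<in>A. map_poly of_int (f x) :: 'a::comm_ring_1 poly)"
  by (induction A rule: infinite_finite_induct) simp_all

lemma of_int_poly_eq_iff [simp]:
  "map_poly of_int p = (map_poly of_int q :: 'a::ring_char_0 poly) \<longleftrightarrow> p = q"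
  by (auto simp: poly_eq_iff coeff_map_poly)

abbreviation ipoly :: "int poly \<Rightarrow> 'a::comm_ring_1 \<Rightarrow> 'a" where
  "ipoly P \<equiv> poly (map_poly of_int P)"

text \<open>Pseudo-division scales the dividend only by a power of the leading coefficient of
  \<open>g\<close>, which is 1 here.\<close>

lemma monic_division:
  fixes f g :: "'a::idom poly"
  assumes "lead_coeff g = 1"
  obtains q r where "f = g * q + r" "r = 0 \<or> degree r < degree g"
proof -
  from assms have "g \<noteq> 0" by auto
  obtain q r where qr: "pseudo_divmod f g = (q, r)"
    by (cases "pseudo_divmod f g")
  with pseudo_divmod[OF \<open>g \<noteq> 0\<close> qr] assms that show ?thesis by simp
qed

lemma small_multiple_eq_0:
  fixes g :: "'a::idom poly"
  assumes "g dvd r" "r = 0 \<or> degree r < degree g"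
  shows "r = 0"
  using assms by (metis dvd_imp_degree_le linorder_not_less)

text \<open>For monic \<open>g\<close> the module Z[x]/(g) is free on the powers of x below the
  degree of \<open>g\<close>, hence torsion-free.\<close>

lemma monic_dvd_const_multD:
  fixes g :: "int poly"
  assumes "lead_coeff g = 1" "c \<noteq> 0" "g dvd [:c:] * f"
  shows "g dvd f"
proof -
  obtain q r where qr: "f = g * q + r" "r = 0 \<or> degree r < degree g"
    using monic_division[OF assms(1)] by blast
  have "g dvd [:c:] * f - g * ([:c:] * q)"
    using assms(3) by (metis dvd_diff dvd_triv_left)
  also have "[:c:] * f - g * ([:c:] * q) = [:c:] * r"
    using qr(1) by (simp add: algebra_simps)
  finally have "g dvd smult c r" by simp
  hence "smult c r = 0"
    by (rule small_multiple_eq_0) (use qr(2) in auto)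
  with assms(2) qr(1) show ?thesis by simp
qed

text \<open>Remainders are coordinates in the free module Z[x]/(g), so a congruence between
  \<open>a f\<close> and \<open>b h\<close> modulo \<open>g\<close> is an equation of scaled
  remainders and can be read coefficient by coefficient.\<close>

lemma monic_dvd_const_diffD:
  fixes g :: "int poly"
  assumes g: "lead_coeff g = 1" and dvd: "g dvd [:a:] * f - [:b:] * h"
    and r: "f = g * q + r" "r = 0 \<or> degree r < degree g"
  shows "b dvd a * coeff r i"
proof -
  obtain q' s where s: "h = g * q' + s" "s = 0 \<or> degree s < degree g"
    using monic_division[OF g] by blast
  have "[:a:] * f - [:b:] * h = g * ([:a:] * q - [:b:] * q') + (smult a r - smult b s)"
    by (simp add: r s algebra_simps smult_diff_right smult_add_right)
  with dvd have "g dvd smult a r - smult b s"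
    by (metis dvd_add_right_iff dvd_triv_left)
  moreover have "smult a r - smult b s = 0 \<or> degree (smult a r - smult b s) < degree g"
  proof (cases "r = 0 \<and> s = 0")
    case False
    hence "degree g > 0" using r(2) s(2) by auto
    moreover have "degree r < degree g \<or> r = 0" "degree s < degree g \<or> s = 0"
      using r s by auto
    ultimately have "degree r < degree g" "degree s < degree g" by auto
    hence "degree (smult a r) < degree g" "degree (smult b s) < degree g"
      by (meson degree_smult_le le_less_trans)+
    thus ?thesis by (simp add: degree_diff_less)
  qed auto
  ultimately have "smult a r - smult b s = 0" by (rule small_multiple_eq_0)
  hence "coeff (smult a r) i = coeff (smult b s) i" by simp
  thus ?thesis by simp
qed

text \<open>The \<open>p\<close>-adic separatedness of the free \<open>\<int>\<close>-module \<open>\<int>[x]/(g)\<close>.\<close>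

lemma monic_dvd_padic:
  fixes g f :: "int poly" and p :: nat
  assumes g: "lead_coeff g = 1" and p: "prime p"
    and ex: "\<And>j. \<exists>a h. \<not> int p dvd a \<and> g dvd [:a:] * f - [:int p ^ j:] * h"
  shows "g dvd f"
proof -
  obtain q r where qr: "f = g * q + r" "r = 0 \<or> degree r < degree g"
    using monic_division[OF g] by blast
  have "coeff r i = 0" for i
  proof (rule ccontr)
    assume nz: "coeff r i \<noteq> 0"
    have *: "int p ^ j dvd coeff r i" for j
    proof -
      obtain a h where a: "\<not> int p dvd a" "g dvd [:a:] * f - [:int p ^ j:] * h"
        using ex by blast
      have "int p ^ j dvd a * coeff r i"
        by (rule monic_dvd_const_diffD[OF g a(2) qr])
      moreover have "coprime (int p ^ j) a"
        using a(1) p by (simp add: prime_imp_coprime)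
      ultimately show ?thesis by (simp add: coprime_dvd_mult_right_iff)
    qed
    obtain j where j: "\<bar>coeff r i\<bar> < 2 ^ j"
      by (metis (full_types) of_nat_less_two_power zero_le_imp_eq_int abs_ge_zero)
    have "(2::int) ^ j \<le> int p ^ j"
      using prime_ge_2_nat[OF p] by (intro power_mono) auto
    also have "\<dots> \<le> \<bar>coeff r i\<bar>"
      using dvd_imp_le_int[OF nz *[of j]] by simp
    finally show False using j by simp
  qed
  hence "r = 0" by (simp add: poly_eqI)
  thus ?thesis using qr by simp
qed


section \<open>The polynomials \<open>x\<^sup>n - 1\<close>\<close>

definition xpow :: "nat \<Rightarrow> int poly" where "xpow n = monom 1 n"

definition cyc1 :: "nat \<Rightarrow> int poly" where "cyc1 n = xpow n - 1"

lemma xpow_mult: "xpow (m * n) = xpow m ^ n"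
  by (simp add: xpow_def monom_power)

lemma ipoly_xpow [simp]: "ipoly (xpow n) z = z ^ n"
  by (simp add: xpow_def map_poly_monom poly_monom)

lemma ipoly_cyc1 [simp]: "ipoly (cyc1 n) z = z ^ n - 1"
  by (simp add: cyc1_def)

lemma degree_cyc1 [simp]: "degree (cyc1 n) = n"
proof (cases "n = 0")
  case True thus ?thesis by (simp add: cyc1_def xpow_def)
next
  case False
  have "degree (monom 1 n + (-1 :: int poly)) = degree (monom (1::int) n)"
    by (rule degree_add_eq_left) (use False in \<open>simp add: degree_monom_eq\<close>)
  thus ?thesis by (simp add: cyc1_def xpow_def degree_monom_eq)
qed

lemma lead_coeff_cyc1: "n > 0 \<Longrightarrow> lead_coeff (cyc1 n) = 1"
  by (simp only: degree_cyc1) (simp add: cyc1_def xpow_def)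

lemma cyc1_nonzero: "n > 0 \<Longrightarrow> cyc1 n \<noteq> 0"
  using degree_cyc1[of n] by (metis degree_0 less_irrefl)

lemma cyc1_mult: "cyc1 (m * n) = cyc1 m * (\<Sum>i<n. xpow m ^ i)"
  unfolding cyc1_def xpow_mult by (rule power_diff_1_eq)

lemma cyc1_dvd: "m dvd n \<Longrightarrow> cyc1 m dvd cyc1 n"
  by (elim dvdE) (simp add: cyc1_mult)

lemma diff_dvd_power_diff: "(a :: 'a::comm_ring_1) - b dvd a ^ n - b ^ n"
  by (metis dvd_triv_left power_diff_sumr2)

text \<open>If \<open>\<ell>k = 1 + tc\<close>, then \<open>T = \<Sum>\<^bsub>i<k\<^esub> y\<^sup>\<ell>\<^sup>i\<close> inverts \<open>\<Sum>\<^bsub>i<\<ell>\<^esub> y\<^sup>i\<close> modulo \<open>y\<^sup>t - 1\<close> up to a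
  multiple of the sum \<open>S\<close> of all powers of \<open>y\<close>, which the correction term \<open>c S\<close> removes.\<close>

lemma geometric_sum_invertible:
  fixes y :: "'a::comm_ring_1"
  assumes "coprime t l" "t > 0" "l > 0"
  shows "\<exists>E. y ^ t - 1 dvd (\<Sum>i<l. y ^ i) * E - of_nat l"
proof -
  obtain k where k: "[l * k = 1] (mod t)"
    using cong_solve_coprime_nat[of l t] assms(1) by (auto simp: coprime_commute)
  \<comment> \<open>Adding \<open>t\<close> makes the inverse of \<open>l\<close> positive, so that
    the subtraction in \<open>l * k' - 1\<close> is not truncated.\<close>
  define k' where "k' = k + t"
  have "[l * k' = 1] (mod t)"
    using k by (simp add: k'_def cong_def algebra_simps)
  moreover have "l * k' \<ge> 1" using assms by (simp add: k'_def Suc_le_eq)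
  ultimately have "t dvd l * k' - 1" by (simp add: cong_altdef_nat)
  then obtain c where "l * k' - 1 = t * c" by (elim dvdE)
  with \<open>l * k' \<ge> 1\<close> have c: "l * k' = 1 + t * c" by linarith
  define S T L where "S = (\<Sum>i<t. y ^ i)" and "T = (\<Sum>i<k'. (y ^ l) ^ i)" and "L = (\<Sum>i<l. y ^ i)"
  define C where "C = (\<Sum>i<c. (y ^ t) ^ i)"
  have split: "(\<Sum>i<m + n. y ^ i) = (\<Sum>i<m. y ^ i) + y ^ m * (\<Sum>i<n. y ^ i)" for m n
    by (induction n) (simp_all add: algebra_simps power_add)
  have geo: "(\<Sum>i<a * b. y ^ i) = (\<Sum>i<a. y ^ i) * (\<Sum>j<b. (y ^ a) ^ j)" for a b
  proof (induction b)
    case (Suc b)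
    show ?case using Suc split[of "a * b" a] by (simp add: algebra_simps power_mult)
  qed auto
  have "L * T = (\<Sum>i<1 + t * c. y ^ i)" unfolding L_def T_def c[symmetric] geo ..
  also have "\<dots> = 1 + y * (S * C)"
    unfolding S_def C_def geo[symmetric] split by simp
  finally have LT: "L * T = 1 + y * (S * C)" .
  \<comment> \<open>Modulo \<open>y ^ t - 1\<close> the powers of \<open>y\<close> fix
    \<open>S\<close>, so \<open>L\<close> and \<open>y * C\<close> act on \<open>S\<close> as the
    integers \<open>l\<close> and \<open>c\<close>.\<close>
  have yS: "y ^ t - 1 dvd y ^ i * S - S" for i
  proof -
    have "y ^ t - 1 = (y - 1) * S" unfolding S_def by (rule power_diff_1_eq)
    moreover have "y - 1 dvd y ^ i - 1" using diff_dvd_power_diff[of y 1 i] by simp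
    ultimately show ?thesis by (metis left_diff_distrib mult_1 mult_dvd_mono dvd_refl)
  qed
  have 1: "y ^ t - 1 dvd L * S - of_nat l * S"
  proof -
    have "L * S - of_nat l * S = (\<Sum>i<l. y ^ i * S - S)"
      by (simp add: L_def sum_distrib_right sum_subtractf)
    thus ?thesis using yS by (simp add: dvd_sum)
  qed
  have 2: "y ^ t - 1 dvd y * S * C - of_nat c * S"
  proof -
    have "y * S * C - of_nat c * S = (\<Sum>i<c. y ^ (t * i + 1) * S - S)"
      by (simp add: C_def sum_distrib_left sum_distrib_right sum_subtractf power_mult mult_ac
          flip: power_mult)
    thus ?thesis using yS by (simp only: dvd_sum)
  qed
  have "L * (of_nat l * T - of_nat c * S) - of_nat l = of_nat l * (L * T) - of_nat c * (L * S) - of_nat l"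
    by (simp add: algebra_simps)
  also have "\<dots> =
    of_nat l * (y * S * C - of_nat c * S) - of_nat c * (L * S - of_nat l * S)"
    unfolding LT by (simp add: algebra_simps)
  finally have "L * (of_nat l * T - of_nat c * S) - of_nat l = \<dots>" .
  moreover have "y ^ t - 1 dvd \<dots>" by (intro dvd_diff dvd_mult 1 2)
  ultimately show ?thesis unfolding L_def by metis
qed

lemma prime_dvd_power_sum_diff:
  fixes a b :: "'a::comm_ring_1"
  assumes p: "prime p"
  shows "of_nat p dvd (a + b) ^ p - (a ^ p + b ^ p)"
proof -
  have p0: "p > 0" using p prime_gt_0_nat by blast
  have "(a + b) ^ p = (\<Sum>k\<in>insert 0 (insert p {1..<p}). of_nat (p choose k) * a ^ k * b ^ (p - k))"
    unfolding binomial_ring using p0 by (intro sum.cong) auto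
  also have "\<dots> = a ^ p + b ^ p + (\<Sum>k\<in>{1..<p}. of_nat (p choose k) * a ^ k * b ^ (p - k))"
    using p0 by simp
  finally have "(a + b) ^ p - (a ^ p + b ^ p) = (\<Sum>k\<in>{1..<p}. of_nat (p choose k) * a ^ k * b ^ (p - k))"
    by simp
  moreover have "of_nat p dvd (of_nat (p choose k) :: 'a)" if "k \<in> {1..<p}" for k
  proof -
    have "p dvd p choose k" using that p by (intro dvd_choose_prime) auto
    thus ?thesis by (metis dvdE dvd_triv_left of_nat_mult)
  qed
  ultimately show ?thesis by (simp only: dvd_sum dvd_mult2)
qed

lemma prime_dvd_power_pow_diff:
  fixes y :: "'a::comm_ring_1"
  assumes p: "prime p"
  shows "of_nat p dvd (y - 1) ^ (p ^ e) - (y ^ (p ^ e) - 1)"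
proof (induction e)
  case (Suc e)
  have 1: "of_nat p dvd (z - 1) ^ p - (z ^ p - 1)" for z :: 'a
  proof -
    have "of_nat p dvd (z + -1) ^ p - (z ^ p + (-1) ^ p)" by (rule prime_dvd_power_sum_diff[OF p])
    \<comment> \<open>For odd \<open>p\<close> the two signs agree; for \<open>p = 2\<close> they
      differ by 2.\<close>
    moreover have "of_nat p dvd (-1) ^ p - (-1 :: 'a)"
    proof (cases "p = 2")
      case True thus ?thesis by simp
    next
      case False
      hence "odd p" using p primes_dvd_imp_eq two_is_prime_nat by blast
      thus ?thesis by simp
    qed
    ultimately have "of_nat p dvd ((z + -1) ^ p - (z ^ p + (-1) ^ p)) + ((-1) ^ p - (-1))"
      by (rule dvd_add)
    thus ?thesis by (simp add: algebra_simps)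
  qed
  have "of_nat p dvd ((y - 1) ^ (p ^ e)) ^ p - (y ^ (p ^ e) - 1) ^ p"
    using Suc diff_dvd_power_diff dvd_trans by blast
  from dvd_add[OF this 1[of "y ^ (p ^ e)"]] show ?case
    by (simp add: algebra_simps flip: power_mult)
qed simp

section \<open>Cyclotomic polynomials\<close>

lemma root_order:
  assumes "\<zeta> \<in> roots_of_unity"
  shows root_order_pos: "root_order \<zeta> > 0" and power_root_order: "\<zeta> ^ root_order \<zeta> = 1"
proof -
  obtain n where "0 < n \<and> \<zeta> ^ n = 1" using assms by (auto simp: roots_of_unity_def)
  hence "0 < root_order \<zeta> \<and> \<zeta> ^ root_order \<zeta> = 1"
    unfolding root_order_def by (rule LeastI)
  thus "root_order \<zeta> > 0" "\<zeta> ^ root_order \<zeta> = 1" by auto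
qed

lemma power_eq_1_iff_root_order:
  assumes "\<zeta> \<in> roots_of_unity"
  shows "\<zeta> ^ n = 1 \<longleftrightarrow> root_order \<zeta> dvd n"
proof
  assume n: "\<zeta> ^ n = 1"
  define r where "r = root_order \<zeta>"
  have "\<zeta> ^ n = (\<zeta> ^ r) ^ (n div r) * \<zeta> ^ (n mod r)"
    by (simp only: power_mult [symmetric] power_add [symmetric] mult_div_mod_eq)
  hence "\<zeta> ^ (n mod r) = 1" using n power_root_order[OF assms] by (simp add: r_def)
  moreover have "n mod r < r" using root_order_pos[OF assms] by (simp add: r_def)
  ultimately have "n mod r = 0"
    using not_less_Least[of "n mod r" "\<lambda>n. 0 < n \<and> \<zeta> ^ n = 1", folded root_order_def]
    by (simp add: r_def)
  thus "root_order \<zeta> dvd n" by (simp add: r_def mod_eq_0_iff_dvd)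
next
  assume "root_order \<zeta> dvd n"
  then obtain k where "n = root_order \<zeta> * k" by (rule dvdE)
  thus "\<zeta> ^ n = 1" using power_root_order[OF assms] by (simp add: power_mult)
qed

lemma root_orderI:
  assumes "\<zeta> ^ n = 1" "n > 0" "\<And>m. m > 0 \<Longrightarrow> \<zeta> ^ m = 1 \<Longrightarrow> n \<le> m"
  shows "root_order \<zeta> = n"
  unfolding root_order_def using assms by (intro Least_equality) auto

definition primitive_roots :: "nat \<Rightarrow> complex set" where
  "primitive_roots s = {\<zeta> \<in> roots_of_unity. root_order \<zeta> = s}"

lemma primitive_roots_UN:
  assumes "n > 0"
  shows "(\<Union>s\<in>{s. s dvd n}. primitive_roots s) = {z. z ^ n = 1}"
proof -
  have "z \<in> roots_of_unity" if "z ^ n = 1" for z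
    using that assms by (auto simp: roots_of_unity_def)
  moreover have "z ^ n = 1 \<longleftrightarrow> root_order z dvd n" if "z \<in> roots_of_unity" for z
    using that by (rule power_eq_1_iff_root_order)
  ultimately show ?thesis unfolding primitive_roots_def by blast
qed

lemma finite_primitive_roots:
  assumes "s > 0"
  shows "finite (primitive_roots s)"
proof (rule finite_subset)
  show "primitive_roots s \<subseteq> {z. z ^ s = 1}"
    by (auto simp: primitive_roots_def power_root_order)
  show "finite {z :: complex. z ^ s = 1}" using finite_roots_unity[of s] assms by simp
qed

lemma prod_roots_unity:
  assumes "n > 0"
  shows "(\<Prod>\<zeta>\<in>{z. z ^ n = 1}. [:- \<zeta>, 1:]) = (map_poly of_int (cyc1 n) :: complex poly)"
proof -
  define P :: "complex poly" where "P = map_poly of_int (cyc1 n)"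
  have P: "P = monom 1 n - 1" by (simp add: P_def cyc1_def xpow_def map_poly_monom)
  have eval: "poly P z = z ^ n - 1" for z by (simp add: P_def)
  have "rsquarefree P"
    unfolding rsquarefree_roots
  proof (intro allI notI, elim conjE)
    fix a assume "poly P a = 0" "poly (pderiv P) a = 0"
    hence "a ^ n = 1" "of_nat n * a ^ (n - 1) = 0"
      by (simp_all add: eval) (simp add: P pderiv_diff pderiv_monom poly_monom)
    thus False using assms by (simp add: power_0_left)
  qed
  hence "smult (lead_coeff P) (\<Prod>z|poly P z = 0. [:- z, 1:]) = P"
    by (rule complex_poly_decompose_rsquarefree)
  moreover have "lead_coeff P = 1"
  proof -
    have "degree P = n" by (simp add: P_def degree_map_poly)
    thus ?thesis using assms by (simp add: P)
  qed
  ultimately show ?thesis unfolding P_def [symmetric] by (simp add: eval)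
qed

definition complex_cyclotomic :: "nat \<Rightarrow> complex poly" where
  "complex_cyclotomic s = (\<Prod>\<zeta>\<in>primitive_roots s. [:- \<zeta>, 1:])"

lemma prod_complex_cyclotomic:
  assumes "n > 0"
  shows "(\<Prod>s\<in>{s. s dvd n}. complex_cyclotomic s) = map_poly of_int (cyc1 n)"
proof -
  have "(\<Prod>s\<in>{s. s dvd n}. complex_cyclotomic s) =
    (\<Prod>\<zeta>\<in>(\<Union>s\<in>{s. s dvd n}. primitive_roots s). [:- \<zeta>, 1:])"
    unfolding complex_cyclotomic_def
  proof (rule prod.UNION_disjoint [symmetric])
    show "\<forall>s\<in>{s. s dvd n}. finite (primitive_roots s)"
      using assms finite_primitive_roots dvd_pos_nat by blast
  qed (use assms in \<open>auto simp: primitive_roots_def\<close>)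
  thus ?thesis by (simp only: primitive_roots_UN[OF assms] prod_roots_unity[OF assms])
qed

text \<open>By induction the cyclotomic polynomials of the proper divisors multiply to a monic
  integer polynomial \<open>G\<close>. Dividing \<open>cyc1 n\<close> by \<open>G\<close> stays in
  Z[x], and the remainder vanishes because over the complex numbers it is a multiple of
  \<open>G\<close> of smaller degree.\<close>

lemma int_cyclotomic_exists:
  assumes "n > 0"
  shows "\<exists>c :: int poly. lead_coeff c = 1 \<and> map_poly of_int c = complex_cyclotomic n"
  using assms
proof (induction n rule: less_induct)
  case (less n)
  define D where "D = {s. s dvd n \<and> s \<noteq> n}"
  have "\<forall>s\<in>D. \<exists>c :: int poly. lead_coeff c = 1 \<and> map_poly of_int c = complex_cyclotomic s"
  proof
    fix s assume "s \<in> D"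
    hence "s < n" "s > 0" using less.prems dvd_imp_le[of s n] by (auto simp: D_def dvd_pos_nat)
    thus "\<exists>c :: int poly. lead_coeff c = 1 \<and> map_poly of_int c = complex_cyclotomic s"
      by (rule less.IH)
  qed
  then obtain c where c: "\<And>s. s \<in> D \<Longrightarrow> lead_coeff (c s) = (1::int)"
    "\<And>s. s \<in> D \<Longrightarrow> map_poly of_int (c s) = complex_cyclotomic s" by metis
  define G where "G = prod c D"
  have fin: "finite D" using less.prems by (simp add: D_def)
  have G: "lead_coeff G = 1" unfolding G_def using c(1) by (simp add: lead_coeff_prod)
  have "{s. s dvd n} = insert n D" by (auto simp: D_def)
  hence eq: "map_poly of_int (cyc1 n) = complex_cyclotomic n * map_poly of_int G"
    using prod_complex_cyclotomic[OF less.prems] fin c(2) by (simp add: D_def G_def)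
  obtain q r where qr: "cyc1 n = G * q + r" "r = 0 \<or> degree r < degree G"
    using monic_division[OF G] by blast
  let ?C = "map_poly of_int :: int poly \<Rightarrow> complex poly"
  have deg: "degree (?C p) = degree p" for p by (simp add: degree_map_poly)
  have "?C G * (complex_cyclotomic n - ?C q) = ?C r"
    using eq unfolding qr(1) by (simp add: algebra_simps)
  hence "?C G dvd ?C r" by (metis dvd_triv_left)
  hence "?C r = 0"
    by (rule small_multiple_eq_0) (use qr(2) in \<open>auto simp: deg\<close>)
  hence r: "r = 0" by (metis map_poly_0 of_int_poly_eq_iff)
  have "?C G \<noteq> 0" using G by (metis deg leading_coeff_0_iff map_poly_0 of_int_poly_eq_iff zero_neq_one)
  moreover have "?C G * ?C q = ?C G * complex_cyclotomic n"
    using eq unfolding qr(1) r by (simp add: algebra_simps)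
  ultimately have "?C q = complex_cyclotomic n" by simp
  moreover have "lead_coeff q = 1"
    using lead_coeff_cyc1[OF less.prems] G unfolding qr(1) r
    by (metis add.right_neutral lead_coeff_mult mult_1)
  ultimately show ?case by blast
qed

definition cyc :: "nat \<Rightarrow> int poly" where
  "cyc n = (SOME c. lead_coeff c = 1 \<and> map_poly of_int c = complex_cyclotomic n)"

lemma
  assumes "n > 0"
  shows lead_coeff_cyc: "lead_coeff (cyc n) = 1"
    and of_int_cyc: "map_poly of_int (cyc n) = complex_cyclotomic n"
  using someI_ex[OF int_cyclotomic_exists[OF assms]] by (simp_all add: cyc_def)

text \<open>This settles existence and uniqueness for the definite description behind
  \<open>cyclotomic\<close>; uniqueness holds because rational polynomials embed into complex
  ones.\<close>

lemma cyclotomic_eq: "n > 0 \<Longrightarrow> cyclotomic n = map_poly of_int (cyc n)"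
  unfolding cyclotomic_def
proof (rule the_equality)
  assume n: "n > 0"
  have *: "cpoly (map_poly of_int p) = map_poly of_int p" for p
    by (simp add: map_poly_map_poly o_def)
  show **: "cpoly (map_poly of_int (cyc n)) =
    (\<Prod>\<zeta>\<in>{\<zeta> \<in> roots_of_unity. root_order \<zeta> = n}. [:- \<zeta>, 1:])"
    using of_int_cyc[OF n] by (simp add: * complex_cyclotomic_def primitive_roots_def)
  fix p assume "cpoly p = (\<Prod>\<zeta>\<in>{\<zeta> \<in> roots_of_unity. root_order \<zeta> = n}. [:- \<zeta>, 1:])"
  with ** have "cpoly p = cpoly (map_poly of_int (cyc n))" by simp
  hence "complex_of_rat (coeff p i) = complex_of_rat (of_int (coeff (cyc n) i))" for i
    by (auto simp: poly_eq_iff coeff_map_poly)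
  thus "p = map_poly of_int (cyc n)" by (simp only: of_rat_eq_iff) (simp add: poly_eq_iff coeff_map_poly)
qed

lemma prod_cyc:
  assumes "n > 0"
  shows "(\<Prod>s\<in>{s. s dvd n}. cyc s) = cyc1 n"
proof -
  have "map_poly of_int (\<Prod>s\<in>{s. s dvd n}. cyc s) = (map_poly of_int (cyc1 n) :: complex poly)"
    using assms by (simp add: of_int_cyc dvd_pos_nat flip: prod_complex_cyclotomic)
  thus ?thesis by (simp only: of_int_poly_eq_iff)
qed

text \<open>Counting \<open>d\<close> itself among the admissible denominators of \<open>\<Lambda>\<^sub>d\<close> keeps all numerators in \<open>\<int>[x]\<close>.\<close>

inductive_set den :: "nat \<Rightarrow> int poly set" for d where
  den_1: "1 \<in> den d"
| den_const: "D \<in> den d \<Longrightarrow> [:int d:] * D \<in> den d"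
| den_x: "D \<in> den d \<Longrightarrow> [:0, 1:] * D \<in> den d"
| den_cyc: "D \<in> den d \<Longrightarrow> s > 0 \<Longrightarrow> \<not> coprime s d \<Longrightarrow> cyc s * D \<in> den d"

section \<open>Admissible denominators: closure properties and inverses modulo
  \<open>cyc1 t\<close>\<close>

lemma den_mult:
  assumes "D \<in> den d" "E \<in> den d"
  shows "D * E \<in> den d"
  using assms(1)
proof induction
  case den_1 thus ?case using assms(2) by simp
next
  case (den_cyc D s)
  thus ?case using den.den_cyc by (simp only: mult.assoc)
qed (simp_all only: mult.assoc den.intros)

lemma den_nonzero: "D \<in> den d \<Longrightarrow> d > 0 \<Longrightarrow> D \<noteq> 0"
proof (induction rule: den.induct)
  case (den_cyc D s)
  thus ?case using lead_coeff_cyc[of s] by auto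
qed auto

lemma den_prod_cyc:
  assumes "finite S" "\<And>s. s \<in> S \<Longrightarrow> s > 0 \<and> \<not> coprime s d"
  shows "prod cyc S \<in> den d"
  using assms proof (induction S rule: finite_induct)
  case empty
  show ?case by (simp add: den_1)
next
  case (insert s S)
  hence "cyc s * prod cyc S \<in> den d" by (intro den_cyc insert.IH) auto
  thus ?case using insert.hyps by simp
qed

text \<open>Cancelling the factorisation of \<open>cyc1 m\<close> from that of
  \<open>cyc1 (m * l)\<close> leaves these indices.\<close>

lemma geometric_sum_eq_prod_cyc:
  assumes "m > 0" "l > 0"
  shows "(\<Sum>i<l. xpow m ^ i) = (\<Prod>s\<in>{s. s dvd m * l \<and> \<not> s dvd m}. cyc s)"
proof -
  define A B where "A = {s. s dvd m}" and "B = {s. s dvd m * l \<and> \<not> s dvd m}"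
  have AB: "{s. s dvd m * l} = A \<union> B" "A \<inter> B = {}" by (auto simp: A_def B_def)
  have "finite (A \<union> B)" using assms by (simp flip: AB(1))
  have "cyc1 m * (\<Sum>i<l. xpow m ^ i) = cyc1 (m * l)" by (rule cyc1_mult [symmetric])
  also have "\<dots> = prod cyc (A \<union> B)"
    using prod_cyc[of "m * l"] assms by (simp only: AB(1) nat_0_less_mult_iff simp_thms)
  also have "\<dots> = prod cyc A * prod cyc B"
    using \<open>finite (A \<union> B)\<close> AB(2) by (simp only: finite_Un prod.union_disjoint)
  also have "prod cyc A = cyc1 m" unfolding A_def by (rule prod_cyc[OF assms(1)])
  finally have "cyc1 m * (\<Sum>i<l. xpow m ^ i) = cyc1 m * prod cyc B" .
  moreover have "cyc1 m \<noteq> 0"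
    using assms(1) by (rule cyc1_nonzero)
  ultimately show ?thesis unfolding B_def by (simp only: mult_cancel_left simp_thms)
qed

text \<open>A divisor of \<open>m * l\<close> coprime to \<open>d\<close> is coprime to
  \<open>l\<close> and so divides \<open>m\<close>; every cyclotomic factor that occurs therefore
  has an index sharing a factor with \<open>d\<close>.\<close>

lemma geometric_sum_in_den:
  assumes "m > 0" "prime l" "l dvd d"
  shows "(\<Sum>i<l. xpow m ^ i) \<in> den d"
proof -
  have l: "l > 0" using assms(2) by (simp add: prime_gt_0_nat)
  have *: "\<not> coprime s d" if "s dvd m * l" "\<not> s dvd m" for s
  proof
    assume "coprime s d"
    hence "coprime s l" using assms(3) coprime_divisors[OF dvd_refl] by blast
    thus False using that by (simp add: coprime_dvd_mult_left_iff)
  qed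
  show ?thesis
    unfolding geometric_sum_eq_prod_cyc[OF assms(1) l]
  proof (rule den_prod_cyc)
    fix s assume s: "s \<in> {s. s dvd m * l \<and> \<not> s dvd m}"
    moreover have "s > 0" using s assms(1) l by (cases "s = 0") auto
    ultimately show "s > 0 \<and> \<not> coprime s d" using * by blast
  qed (use assms(1) l in simp)
qed

text \<open>Primes common to \<open>n\<close> and \<open>d\<close> are stripped from
  \<open>n\<close> one at a time; each quotient is a geometric sum and becomes a unit of
  Lambda_d.\<close>

lemma cyc1_coprime_part:
  assumes "n > 0"
  shows "\<exists>t W. t > 0 \<and> coprime t d \<and> W \<in> den d \<and> cyc1 n = cyc1 t * W"
  using assms
proof (induction n rule: less_induct)
  case (less n)
  show ?case
  proof (cases "coprime n d")
    case True
    thus ?thesis using less.prems by (intro exI[of _ n] exI[of _ 1]) (auto intro: den.intros)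
  next
    case False
    then obtain l where l: "prime l" "l dvd n" "l dvd d"
      using prime_factor_nat[of "gcd n d"] by (auto simp: coprime_iff_gcd_eq_1)
    then obtain m where m: "n = m * l" by (metis dvdE mult.commute)
    have "m > 0" "m < n" using m less.prems prime_gt_1_nat[OF l(1)] by auto
    then obtain t W where tW: "t > 0" "coprime t d" "W \<in> den d" "cyc1 m = cyc1 t * W"
      using less.IH by blast
    have "cyc1 n = cyc1 t * (W * (\<Sum>i<l. xpow m ^ i))"
      unfolding m cyc1_mult tW(4) by (simp add: mult.assoc)
    moreover have "W * (\<Sum>i<l. xpow m ^ i) \<in> den d"
      using tW(3) geometric_sum_in_den[OF \<open>m > 0\<close> l(1,3)] by (rule den_mult)
    ultimately show ?thesis using tW by blast
  qed
qed

text \<open>Each generator of \<open>den d\<close> is a unit modulo \<open>cyc1 t\<close> once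
  \<open>d\<close> is inverted. For \<open>cyc s\<close> take a prime \<open>l\<close> dividing both
  \<open>s\<close> and \<open>d\<close>: \<open>cyc s\<close> divides a geometric sum of length
  \<open>l\<close>, and \<open>l\<close> is coprime to \<open>t\<close>, so that sum is invertible
  up to the constant \<open>l\<close>.\<close>

lemma den_invertible:
  assumes "D \<in> den d" "d > 0" "coprime t d" "t > 0"
  shows "\<exists>E k. cyc1 t dvd D * E - [:int d ^ k:]"
  using assms(1)
proof induction
  case den_1
  show ?case by (intro exI[of _ 1] exI[of _ 0]) (simp add: one_pCons)
next
  case (den_const D)
  then obtain E k where "cyc1 t dvd D * E - [:int d ^ k:]" by blast
  hence "cyc1 t dvd [:int d:] * (D * E - [:int d ^ k:])" by (rule dvd_mult)
  hence "cyc1 t dvd [:int d:] * D * E - [:int d ^ Suc k:]" by (simp add: algebra_simps smult_diff_right)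
  thus ?case by blast
next
  case (den_x D)
  then obtain E k where E: "cyc1 t dvd D * E - [:int d ^ k:]" by blast
  \<comment> \<open>The inverse of x modulo \<open>cyc1 t\<close> is x^(t-1).\<close>
  have "[:0, 1:] * xpow (t - 1) = xpow t"
    using assms(4) by (cases t) (simp_all add: xpow_def monom_Suc)
  moreover have "x * D * (E * p) - Q = (x * p) * (D * E - Q) + (x * p - 1) * Q" for x p Q :: "int poly"
    by (simp add: algebra_simps)
  ultimately have "[:0, 1:] * D * (E * xpow (t - 1)) - [:int d ^ k:] =
      xpow t * (D * E - [:int d ^ k:]) + cyc1 t * [:int d ^ k:]"
    by (metis cyc1_def)
  moreover have "cyc1 t dvd \<dots>" by (rule dvd_add[OF dvd_mult[OF E] dvd_triv_left])
  ultimately show ?case by metis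
next
  case (den_cyc D s)
  obtain E k where E: "cyc1 t dvd D * E - [:int d ^ k:]" using den_cyc.IH by blast
  obtain l where l: "prime l" "l dvd s" "l dvd d"
    using den_cyc.hyps prime_factor_nat[of "gcd s d"] by (auto simp: coprime_iff_gcd_eq_1)
  obtain m where m: "s = m * l" using l(2) by (metis dvdE mult.commute)
  obtain c where c: "d = l * c" using l(3) by (rule dvdE)
  have m0: "m > 0" and l0: "l > 0" using m den_cyc.hyps by auto
  have "s \<in> {s. s dvd m * l \<and> \<not> s dvd m}"
    using m m0 prime_gt_1_nat[OF l(1)] by (auto dest: dvd_imp_le)
  hence "cyc s dvd (\<Sum>i<l. xpow m ^ i)"
    unfolding geometric_sum_eq_prod_cyc[OF m0 l0]
    by (intro dvd_prodI) (use m0 l0 in auto)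
  then obtain W where W: "(\<Sum>i<l. xpow m ^ i) = cyc s * W" by (rule dvdE)
  have "coprime t l" using assms(3) l(3) coprime_divisors[OF dvd_refl] by blast
  then obtain F where F: "xpow m ^ t - 1 dvd (\<Sum>i<l. xpow m ^ i) * F - of_nat l"
    using geometric_sum_invertible assms(4) l0 by blast
  have "cyc1 t dvd cyc1 (m * t)" by (rule cyc1_dvd) simp
  hence "cyc1 t dvd cyc s * W * F - of_nat l"
    using F unfolding W cyc1_def xpow_mult by (rule dvd_trans)
  \<comment> \<open>The cofactor \<open>c\<close> of \<open>l\<close> in \<open>d\<close> turns the
    constant \<open>l\<close> into \<open>d\<close>, so that only powers of \<open>d\<close>
    accumulate.\<close>
  hence "cyc1 t dvd (cyc s * W * F - of_nat l) * (of_nat c * (D * E)) + of_nat d * (D * E - [:int d ^ k:])"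
    using E by (intro dvd_add dvd_mult dvd_mult2)
  moreover have "(cyc s * W * F - of_nat l) * (of_nat c * (D * E)) + of_nat d * (D * E - [:int d ^ k:]) =
     cyc s * D * (W * F * of_nat c * E) - of_nat d * [:int d ^ k:]"
    by (simp add: c algebra_simps)
  moreover have "of_nat d * [:int d ^ k:] = [:int d ^ Suc k:]"
    by (simp add: of_nat_poly)
  ultimately show ?case by metis
qed

section \<open>Vanishing at roots of unity of prime power order\<close>

lemma of_int_poly_pCons [simp]:
  "map_poly of_int (pCons a p) = (pCons (of_int a) (map_poly of_int p) :: 'a::ring_1 poly)"
  by (intro poly_eqI) (simp add: coeff_map_poly coeff_pCons split: nat.splits)

lemma int_minimal_poly:
  fixes z :: complex
  assumes "z ^ r = 1" "r > 0"
  obtains m :: "int poly" where "lead_coeff m = 1" "degree m > 0" "ipoly m z = 0"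
    "\<And>A. ipoly A z = 0 \<Longrightarrow> m dvd A"
proof -
  define Q where "Q p \<longleftrightarrow> p \<noteq> 0 \<and> ipoly p z = 0" for p :: "int poly"
  have "Q (cyc1 r)" using assms cyc1_nonzero by (simp add: Q_def)
  then obtain p0 where p0: "Q p0" "\<And>p. Q p \<Longrightarrow> degree p0 \<le> degree p"
    using ex_has_least_nat[of Q _ degree] by blast
  define m0 where "m0 = primitive_part p0"
  have p0_eq: "[:content p0:] * m0 = p0" by (simp add: m0_def)
  have c0: "content p0 \<noteq> 0" using p0(1) by (simp add: Q_def)
  have content: "content m0 = 1" using p0(1) by (simp add: m0_def Q_def)
  have "ipoly ([:content p0:] * m0) z = 0" unfolding p0_eq using p0(1) by (simp add: Q_def)
  hence root: "ipoly m0 z = 0" using c0 by (simp only: of_int_poly_mult poly_mult) simp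
  have deg: "degree m0 = degree p0" by (simp add: m0_def)
  have dvd: "m0 dvd A" if A: "ipoly A z = 0" for A
  proof -
    have "m0 \<noteq> 0" using content by auto
    define \<rho> where "\<rho> = pseudo_mod A m0"
    obtain a q where aq: "a \<noteq> 0" "smult a A = m0 * q + \<rho>"
      using pseudo_mod(1)[OF \<open>m0 \<noteq> 0\<close>, of A] unfolding \<rho>_def by blast
    have \<rho>: "\<rho> = 0 \<or> degree \<rho> < degree m0"
      using pseudo_mod(2)[OF \<open>m0 \<noteq> 0\<close>, of A] unfolding \<rho>_def .
    have "ipoly ([:a:] * A) z = ipoly (m0 * q + \<rho>) z" using aq(2) by simp
    hence "ipoly \<rho> z = 0" using A root by (simp only: of_int_poly_mult of_int_poly_add poly_mult poly_add) simp
    hence "\<rho> = 0" using p0(2)[of \<rho>] \<rho> deg unfolding Q_def by linarith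
    hence eq: "smult a A = m0 * q" using aq by simp
    \<comment> \<open>Contents are multiplicative and \<open>m0\<close> is primitive, so the scaling
      factor \<open>a\<close> of the pseudo-division can be cancelled from \<open>q\<close>.\<close>
    hence "content (smult a A) = content (m0 * q)" by simp
    hence "content q = normalize a * content A" by (simp add: content_mult content)
    hence "a dvd content q" by simp
    hence "[:a:] dvd q" by (simp only: const_poly_dvd_iff_dvd_content)
    then obtain q' where "q = [:a:] * q'" by (rule dvdE)
    hence "[:a:] * A = [:a:] * (m0 * q')" using eq by simp
    moreover have "[:a:] \<noteq> 0" using aq(1) by simp
    ultimately have "A = m0 * q'" by (simp only: mult_cancel_left simp_thms)
    thus ?thesis by simp
  qed
  have "ipoly (cyc1 r) z = 0" using assms by simp
  then obtain q where q: "cyc1 r = m0 * q" using dvd by (metis dvdE)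
  have "lead_coeff m0 * lead_coeff q = 1"
    using lead_coeff_cyc1[OF assms(2)] unfolding q lead_coeff_mult .
  hence lc: "lead_coeff m0 = 1 \<or> lead_coeff m0 = -1" using zmult_eq_1_iff by blast
  have degpos: "degree m0 > 0"
  proof (rule ccontr)
    assume "\<not> degree m0 > 0"
    then obtain c where "m0 = [:c:]" by (metis degree_eq_zeroE gr0I)
    thus False using root lc by auto
  qed
  show thesis
  proof (cases "lead_coeff m0 = 1")
    case True
    show thesis by (rule that[OF True degpos root dvd])
  next
    case False
    have neg: "map_poly of_int (- m0) = (- map_poly of_int m0 :: complex poly)"
      by (intro poly_eqI) (simp add: coeff_map_poly)
    show thesis
      by (rule that[of "- m0"]) (use False lc degpos root dvd in \<open>simp_all add: neg\<close>)
  qed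
qed

lemma prime_dvd_minimal_poly_at_1:
  fixes z :: complex
  assumes p: "prime p" and z: "z ^ (p ^ e) = 1"
    and m: "lead_coeff m = 1" "degree m > 0" "\<And>A. ipoly A z = 0 \<Longrightarrow> m dvd A"
  shows "int p dvd poly m 1"
proof -
  define r C where "r = p ^ e" and "C = poly m 1"
  have "[:- 1, 1:] dvd m - [:C:]" by (simp add: C_def flip: poly_eq_0_iff_dvd)
  then obtain w where w: "m - [:C:] = [:- 1, 1:] * w" by (rule dvdE)
  have x1: "[:- 1, 1:] = xpow 1 - (1 :: int poly)"
    by (simp add: xpow_def monom_Suc one_pCons)
  obtain V where V: "(xpow 1 - 1) ^ r - (xpow 1 ^ r - 1) = of_nat p * V"
    using prime_dvd_power_pow_diff[OF p, of "xpow 1" e] unfolding r_def by (rule dvdE)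
  have pow: "[:- 1, 1:] ^ r = cyc1 r + of_nat p * V"
    unfolding x1 using V xpow_mult[of 1 r] by (simp add: cyc1_def algebra_simps)
  have "m dvd cyc1 r" by (rule m(3)) (simp add: r_def z)
  \<comment> \<open>Modulo \<open>m\<close> the constant \<open>C\<close> equals (x-1)(-w). Its
    power of exponent \<open>r\<close> contains (x-1)^r, which is \<open>cyc1 r\<close> plus a
    multiple of \<open>p\<close>, and \<open>m\<close> divides \<open>cyc1 r\<close>.\<close>
  have "[:C:] - [:- 1, 1:] * (- w) = m"
    using w by (simp only: mult_minus_right diff_minus_eq_add diff_eq_eq add.commute)
  hence "m dvd [:C:] - [:- 1, 1:] * (- w)" by (simp only: dvd_refl)
  hence "m dvd [:C:] ^ r - ([:- 1, 1:] * (- w)) ^ r"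
    using diff_dvd_power_diff dvd_trans by blast
  moreover have "m dvd cyc1 r * (- w) ^ r" using \<open>m dvd cyc1 r\<close> by (rule dvd_mult2)
  ultimately have "m dvd [:C:] ^ r - ([:- 1, 1:] * (- w)) ^ r + cyc1 r * (- w) ^ r" by (rule dvd_add)
  also have "[:C:] ^ r - ([:- 1, 1:] * (- w)) ^ r + cyc1 r * (- w) ^ r = [:C:] ^ r - of_nat p * (V * (- w) ^ r)"
    unfolding power_mult_distrib pow by (simp add: algebra_simps)
  also have "\<dots> = [:1:] * [:C ^ r:] - [:int p:] * (V * (- w) ^ r)"
    by (simp add: poly_const_pow of_nat_poly)
  finally have "m dvd [:1:] * [:C ^ r:] - [:int p:] * (V * (- w) ^ r)" .
  \<comment> \<open>As \<open>m\<close> has positive degree, the constant \<open>C ^ r\<close> is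
    its own remainder.\<close>
  hence "int p dvd 1 * coeff [:C ^ r:] 0"
    by (rule monic_dvd_const_diffD[OF m(1), where q = 0]) (use m(2) in auto)
  hence "int p dvd C ^ r" by simp
  thus ?thesis using p unfolding C_def by (metis prime_dvd_power prime_nat_int_transfer)
qed

text \<open>The minimal polynomials are split off one by one, each contributing a prime factor to
  the value at 1. The ranking makes \<open>z\<close> the element of smallest order in each induction
  step, which keeps the remaining zeros on the cofactor \<open>B\<close>.\<close>

lemma zeros_imp_dvd_value_at_1:
  assumes "finite Z" "inj_on root_order Z"
    and "\<And>z. z \<in> Z \<Longrightarrow> z \<in> roots_of_unity \<and> primepow (root_order z) \<and> coprime (root_order z) d"
    and "\<And>z. z \<in> Z \<Longrightarrow> ipoly A z = 0"
  shows "\<exists>c. coprime c d \<and> c \<ge> 2 ^ card Z \<and> int c dvd poly A 1"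
  using assms
proof (induction Z arbitrary: A rule: finite_ranking_induct[where f = "\<lambda>z. - int (root_order z)"])
  case empty
  show ?case by (intro exI[of _ 1]) simp
next
  case (insert z Z)
  show ?case
  proof (cases "z \<in> Z")
    case True
    thus ?thesis using insert.IH[of A] insert.prems by (simp add: insert_absorb)
  next
    case False
    obtain p e where p: "prime p" and e: "e > 0" and r: "root_order z = p ^ e"
      using insert.prems(2)[of z] by (auto simp: primepow_def)
    have zu: "z \<in> roots_of_unity" and copr: "coprime (p ^ e) d"
      using insert.prems(2)[of z] r by auto
    have z1: "z ^ (p ^ e) = 1" using power_root_order[OF zu] r by simp
    obtain m where m: "lead_coeff m = 1" "degree m > 0" "ipoly m z = 0"
      "\<And>A. ipoly A z = 0 \<Longrightarrow> m dvd A"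
      using int_minimal_poly[OF z1] p prime_gt_0_nat by auto
    obtain B where B: "A = m * B" using m(4)[of A] insert.prems(3)[of z] by auto
    have "ipoly B y = 0" if y: "y \<in> Z" for y
    proof -
      have yu: "y \<in> roots_of_unity" using insert.prems(2)[of y] y by auto
      have "ipoly m y \<noteq> 0"
      proof
        assume "ipoly m y = 0"
        moreover have "m dvd cyc1 (p ^ e)" by (rule m(4)) (simp add: z1)
        then obtain k where "cyc1 (p ^ e) = m * k" by (rule dvdE)
        ultimately have "ipoly (cyc1 (p ^ e)) y = 0"
          by (simp only: of_int_poly_mult poly_mult mult_zero_left)
        hence "root_order y dvd root_order z"
          unfolding r using power_eq_1_iff_root_order[OF yu, of "p ^ e"] by simp
        hence "root_order y \<le> root_order z" using root_order_pos[OF zu] by (rule dvd_imp_le)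
        moreover have "root_order z \<le> root_order y" using insert.hyps(2)[OF y] by simp
        ultimately have "root_order y = root_order z" by simp
        with insert.prems(1) y False show False by (auto simp: inj_on_def)
      qed
      moreover have "ipoly A y = 0" using insert.prems(3) y by auto
      ultimately show ?thesis by (simp add: B)
    qed
    then obtain c where c: "coprime c d" "c \<ge> 2 ^ card Z" "int c dvd poly B 1"
      using insert.IH[of B] insert.prems(1,2) by auto
    have "int p dvd poly m 1" by (rule prime_dvd_minimal_poly_at_1[OF p z1 m(1,2,4)])
    hence "int (p * c) dvd poly A 1" unfolding B using c(3) by (simp add: mult_dvd_mono)
    moreover have "coprime p d" using copr e by simp
    hence "coprime (p * c) d" using c(1) by simp
    moreover have "2 ^ card (insert z Z) \<le> p * c"
      using insert.hyps(1) False c(2) prime_ge_2_nat[OF p] by (simp add: mult_le_mono)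
    ultimately show ?thesis by blast
  qed
qed

section \<open>Fractions with admissible denominators\<close>

definition phi :: "int poly \<Rightarrow> rat poly fract" where
  "phi P = to_fract (map_poly of_int P)"

lemma phi_0 [simp]: "phi 0 = 0" and phi_1 [simp]: "phi 1 = 1"
  and phi_add [simp]: "phi (P + Q) = phi P + phi Q"
  and phi_diff [simp]: "phi (P - Q) = phi P - phi Q"
  and phi_mult [simp]: "phi (P * Q) = phi P * phi Q"
  by (simp_all add: phi_def)

lemma phi_power [simp]: "phi (P ^ n) = phi P ^ n"
  by (induction n) simp_all

lemma phi_prod [simp]: "phi (prod f A) = (\<Prod>x\<in>A. phi (f x))"
  by (induction A rule: infinite_finite_induct) simp_all

lemma phi_uminus [simp]: "phi (- P) = - phi P"
  using phi_diff[of 0 P] by (simp del: phi_diff)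

lemma phi_eq_iff [simp]: "phi P = phi Q \<longleftrightarrow> P = Q"
  by (simp add: phi_def)

lemma phi_eq_0_iff [simp]: "phi P = 0 \<longleftrightarrow> P = 0"
  using phi_eq_iff[of P 0] by (simp del: phi_eq_iff)

lemma phi_divide_eq_iff:
  assumes "D \<noteq> 0" "E \<noteq> 0"
  shows "phi P / phi D = phi Q / phi E \<longleftrightarrow> P * E = Q * D"
proof -
  have "phi P / phi D = phi Q / phi E \<longleftrightarrow> phi (P * E) = phi (Q * D)"
    using assms by (simp add: frac_eq_eq)
  thus ?thesis by (simp only: phi_eq_iff)
qed

definition fracs :: "nat \<Rightarrow> rat poly fract set" where
  "fracs d = {phi P / phi D | P D. D \<in> den d}"

lemma fracsI: "D \<in> den d \<Longrightarrow> phi P / phi D \<in> fracs d"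
  by (auto simp: fracs_def)

lemma phi_in_fracs: "phi P \<in> fracs d"
  using fracsI[OF den_1, of P] by simp

lemma fracs_add:
  assumes "d > 0" "x \<in> fracs d" "y \<in> fracs d"
  shows "x + y \<in> fracs d"
proof -
  obtain P D Q E where *: "x = phi P / phi D" "y = phi Q / phi E" "D \<in> den d" "E \<in> den d"
    using assms by (auto simp: fracs_def)
  have "x + y = phi (P * E + Q * D) / phi (D * E)"
    using * assms(1) by (simp add: den_nonzero add_frac_eq)
  thus ?thesis using fracsI den_mult * by metis
qed

lemma fracs_mult:
  assumes "x \<in> fracs d" "y \<in> fracs d"
  shows "x * y \<in> fracs d"
proof -
  obtain P D Q E where *: "x = phi P / phi D" "y = phi Q / phi E" "D \<in> den d" "E \<in> den d"
    using assms by (auto simp: fracs_def)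
  have "x * y = phi (P * Q) / phi (D * E)" using * by simp
  thus ?thesis using fracsI den_mult * by metis
qed

lemma fracs_uminus: "x \<in> fracs d \<Longrightarrow> - x \<in> fracs d"
  using fracs_mult[OF phi_in_fracs[of "-1"], of x] by simp

lemma fracs_diff: "d > 0 \<Longrightarrow> x \<in> fracs d \<Longrightarrow> y \<in> fracs d \<Longrightarrow> x - y \<in> fracs d"
  using fracs_add[of d x "- y"] fracs_uminus by simp

lemma den_cancel:
  assumes "D \<in> den d" "d > 0" "coprime t d" "t > 0" "cyc1 t dvd Y * D"
  shows "cyc1 t dvd Y"
proof -
  obtain E k where E: "cyc1 t dvd D * E - [:int d ^ k:]"
    using den_invertible[OF assms(1-4)] by blast
  have "cyc1 t dvd Y * D * E - Y * (D * E - [:int d ^ k:])"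
    by (rule dvd_diff[OF dvd_mult2[OF assms(5)] dvd_mult[OF E]])
  also have "Y * D * E - Y * (D * E - [:int d ^ k:]) = [:int d ^ k:] * Y"
    by (simp only: right_diff_distrib mult_ac)
  finally have "cyc1 t dvd [:int d ^ k:] * Y" .
  thus ?thesis
    using monic_dvd_const_multD[OF lead_coeff_cyc1[OF assms(4)], of "int d ^ k" Y] assms(2) by simp
qed

definition qpoly :: "nat \<Rightarrow> nat \<Rightarrow> int poly" where
  "qpoly d n = (\<Prod>i = 1..n. 1 - xpow (d * i))"

lemma qpoly_dvd: "m \<le> n \<Longrightarrow> qpoly d m dvd qpoly d n"
  unfolding qpoly_def by (intro prod_dvd_prod_subset) auto

lemma cyc1_power_dvd_qpoly:
  assumes "t > 0" "t * m \<le> n"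
  shows "cyc1 t ^ m dvd qpoly d n"
proof -
  have "cyc1 t ^ m = (\<Prod>j\<in>{1..m}. cyc1 t)" by simp
  also have "\<dots> dvd (\<Prod>j\<in>{1..m}. 1 - xpow (d * (t * j)))"
  proof (rule prod_dvd_prod)
    fix j
    have "cyc1 t dvd cyc1 (d * (t * j))" by (rule cyc1_dvd) simp
    thus "cyc1 t dvd 1 - xpow (d * (t * j))" by (metis cyc1_def dvd_minus_iff minus_diff_eq)
  qed
  also have "\<dots> = (\<Prod>i\<in>(\<lambda>j. t * j) ` {1..m}. 1 - xpow (d * i))"
    by (subst prod.reindex) (use assms(1) in \<open>auto intro: inj_onI\<close>)
  also have "\<dots> dvd qpoly d (t * m)"
    unfolding qpoly_def by (rule prod_dvd_prod_subset) (use assms(1) in \<open>auto simp: Suc_le_eq\<close>)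
  also have "\<dots> dvd qpoly d n" by (rule qpoly_dvd[OF assms(2)])
  finally show ?thesis .
qed


section \<open>Coherent families and orders of vanishing\<close>

definition coherent :: "nat \<Rightarrow> (nat \<Rightarrow> rat poly fract) \<Rightarrow> bool" where
  "coherent d h \<longleftrightarrow> (\<forall>n. h n \<in> fracs d) \<and>
     (\<forall>m n. m \<le> n \<longrightarrow> (\<exists>l\<in>fracs d. h n - h m = phi (qpoly d m) * l))"

definition vanishes :: "nat \<Rightarrow> nat \<Rightarrow> nat \<Rightarrow> rat poly fract \<Rightarrow> bool" where
  "vanishes d t m y \<longleftrightarrow> (\<exists>A. \<exists>D\<in>den d. y = phi (cyc1 t ^ m * A) / phi D)"

lemma coherent_vanishing_congruence:
  assumes h: "coherent d h" and d: "d > 0" and t: "coprime t d" "t > 0"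
    and MN: "t * Suc m \<le> N" "N \<le> M"
    and A: "D \<in> den d" "h N = phi (cyc1 t ^ m * A) / phi D"
    and B: "D' \<in> den d" "h M = phi (cyc1 t ^ m * B) / phi D'"
  shows "cyc1 t dvd B * D - A * D'"
proof -
  obtain l where l: "l \<in> fracs d" "h M - h N = phi (qpoly d N) * l"
    using h MN(2) unfolding coherent_def by blast
  obtain P E where PE: "l = phi P / phi E" "E \<in> den d" using l(1) by (auto simp: fracs_def)
  obtain R where R: "qpoly d N = cyc1 t ^ Suc m * R"
    using cyc1_power_dvd_qpoly[OF t(2) MN(1)] by (rule dvdE)
  have nz: "phi D \<noteq> 0" "phi D' \<noteq> 0" "phi E \<noteq> 0"
    using A(1) B(1) PE(2) d by (simp_all add: den_nonzero)
  define F where "F = phi (cyc1 t)"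
  have F: "F \<noteq> 0" using cyc1_nonzero[OF t(2)] by (simp add: F_def)
  have "F ^ m * phi B / phi D' - F ^ m * phi A / phi D = F ^ Suc m * phi R * (phi P / phi E)"
    using l(2) unfolding A(2) B(2) R PE(1) F_def by simp
  hence "F ^ m * ((phi B * phi D - phi A * phi D') * phi E) = F ^ m * (F * (phi R * phi P * phi D * phi D'))"
    using nz by (simp add: field_simps)
  hence "(phi B * phi D - phi A * phi D') * phi E = F * (phi R * phi P * phi D * phi D')"
    using F by simp
  hence "phi ((B * D - A * D') * E) = phi (cyc1 t * (R * P * D * D'))"
    by (simp add: F_def)
  hence "cyc1 t dvd (B * D - A * D') * E" by (simp only: phi_eq_iff dvd_triv_left)
  thus ?thesis by (rule den_cancel[OF PE(2) d t])
qed

lemma vanishes_at_1: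
  assumes h: "coherent d h" and d: "d > 0"
    and W: "infinite W" "inj_on root_order W"
      "\<And>z. z \<in> W \<Longrightarrow> z \<in> roots_of_unity \<and> primepow (root_order z) \<and> coprime (root_order z) d"
    and zero: "\<And>z N P D. z \<in> W \<Longrightarrow> N \<ge> root_order z \<Longrightarrow> D \<in> den d \<Longrightarrow> h N = phi P / phi D \<Longrightarrow> ipoly P z = 0"
  shows "N \<ge> m \<Longrightarrow> vanishes d 1 m (h N)"
proof (induction m arbitrary: N)
  case 0
  have "h N \<in> fracs d" using h by (simp add: coherent_def)
  thus ?case by (auto simp: vanishes_def fracs_def)
next
  case (Suc m)
  obtain A D where A: "D \<in> den d" "h N = phi (cyc1 1 ^ m * A) / phi D"
    using Suc.IH[of N] Suc.prems unfolding vanishes_def by auto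
  have cyc1_1: "cyc1 1 = [:- 1, 1:]" by (simp add: cyc1_def xpow_def monom_Suc one_pCons)
  define a where "a = poly A 1"
  have "a = 0"
  proof (rule ccontr)
    assume "a \<noteq> 0"
    obtain K where K: "\<bar>a\<bar> < 2 ^ K"
      by (metis (full_types) of_nat_less_two_power zero_le_imp_eq_int abs_ge_zero)
    obtain Z where Z: "finite Z" "card Z = K" "Z \<subseteq> W"
      using infinite_arbitrarily_large[OF W(1)] by blast
    define M where "M = N + (\<Sum>z\<in>Z. root_order z)"
    obtain B D' where B: "D' \<in> den d" "h M = phi (cyc1 1 ^ m * B) / phi D'"
      using Suc.IH[of M] Suc.prems unfolding vanishes_def M_def by auto
    have "ipoly B z = 0" if z: "z \<in> Z" for z
    proof -
      have "root_order z \<le> M"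
        using member_le_sum[of z Z root_order] Z(1) z by (simp add: M_def)
      hence "ipoly (cyc1 1 ^ m * B) z = 0" using zero B z Z(3) by blast
      moreover have "z \<noteq> 1"
      proof
        assume "z = 1"
        hence "root_order z = 1" by (intro root_orderI) auto
        moreover have "primepow (root_order z)" using W(3) z Z(3) by blast
        ultimately show False by simp
      qed
      ultimately show ?thesis by simp
    qed
    then obtain c where c: "coprime c d" "c \<ge> 2 ^ card Z" "int c dvd poly B 1"
      using zeros_imp_dvd_value_at_1[OF Z(1) inj_on_subset[OF W(2) Z(3)], of d B] W(3) Z(3) by blast
    have "cyc1 1 dvd B * D - A * D'"
      by (rule coherent_vanishing_congruence[OF h d _ _ _ _ A B]) (use Suc.prems in \<open>auto simp: M_def\<close>)
    hence "poly (B * D - A * D') 1 = 0" unfolding cyc1_1 by (simp only: poly_eq_0_iff_dvd)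
    hence BD: "poly B 1 * poly D 1 = a * poly D' 1" by (simp add: a_def)
    obtain E k where "cyc1 1 dvd D' * E - [:int d ^ k:]"
      using den_invertible[OF B(1) d, of 1] by auto
    hence "poly (D' * E - [:int d ^ k:]) 1 = 0" unfolding cyc1_1 by (simp only: poly_eq_0_iff_dvd)
    hence E: "poly D' 1 * poly E 1 = int d ^ k" by simp
    have "a * int d ^ k = a * poly D' 1 * poly E 1" by (simp only: mult.assoc flip: E)
    also have "\<dots> = poly B 1 * (poly D 1 * poly E 1)" by (simp only: mult.assoc flip: BD)
    finally have "a * int d ^ k = poly B 1 * (poly D 1 * poly E 1)" .
    hence "int c dvd a * int d ^ k" using c(3) by (simp only: dvd_mult2)
    moreover have "coprime (int c) (int d ^ k)" using c(1) by simp
    ultimately have "int c dvd a" by (simp add: coprime_dvd_mult_left_iff)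
    hence "int c \<le> \<bar>a\<bar>" using dvd_imp_le_int[OF \<open>a \<noteq> 0\<close>, of "int c"] by simp
    moreover have "2 ^ K \<le> int c" using c(2) Z(2) by (metis of_nat_le_iff of_nat_numeral of_nat_power)
    ultimately show False using K by linarith
  qed
  hence "cyc1 1 dvd A" unfolding cyc1_1 a_def by (simp only: poly_eq_0_iff_dvd)
  then obtain A' where "A = cyc1 1 * A'" by (rule dvdE)
  hence "cyc1 1 ^ m * A = cyc1 1 ^ Suc m * A'" by simp
  with A show ?case unfolding vanishes_def by metis
qed

lemma coprime_cyc1_geometric_sum:
  assumes "n > 0" "p > 0"
  shows "coprime (cyc1 n) (\<Sum>i<p. xpow n ^ i)"
proof (rule coprimeI)
  fix c assume c: "c dvd cyc1 n" "c dvd (\<Sum>i<p. xpow n ^ i)"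
  have "cyc1 n dvd (\<Sum>i<p. xpow n ^ i - 1)"
  proof (rule dvd_sum)
    show "cyc1 n dvd xpow n ^ i - 1" for i
      unfolding cyc1_def using diff_dvd_power_diff[of "xpow n" 1 i] by simp
  qed
  hence "c dvd (\<Sum>i<p. xpow n ^ i) - (\<Sum>i<p. xpow n ^ i - 1)"
    by (rule dvd_diff[OF c(2) dvd_trans[OF c(1)]])
  also have "\<dots> = [:int p:]" by (simp add: sum_subtractf of_nat_poly)
  finally have "degree c = 0" using assms(2) dvd_imp_degree_le[of c "[:int p:]"] by simp
  then obtain a where a: "c = [:a:]" by (rule degree_eq_zeroE)
  have "a dvd lead_coeff (cyc1 n)" using c(1) unfolding a by (simp only: const_poly_dvd_iff)
  thus "is_unit c" unfolding a using lead_coeff_cyc1[OF assms(1)] by (simp add: is_unit_const_poly_iff)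
qed

text \<open>Vanishing to infinite order spreads from \<open>n\<close> to \<open>np\<close> because \<open>(x\<^sup>n - 1)\<^sup>p\<close> is divisible
  by \<open>p\<close> modulo \<open>x\<^sup>n\<^sup>p - 1\<close>.\<close>

lemma vanishes_step:
  assumes h: "coherent d h" and d: "d > 0" and p: "prime p" "coprime p d"
    and n: "n > 0" "coprime n d"
    and IH: "\<And>m N. N \<ge> n * m \<Longrightarrow> vanishes d n m (h N)"
  shows "N \<ge> n * p * m \<Longrightarrow> vanishes d (n * p) m (h N)"
proof (induction m arbitrary: N)
  case 0
  have "h N \<in> fracs d" using h by (simp add: coherent_def)
  thus ?case by (auto simp: vanishes_def fracs_def)
next
  case (Suc m)
  define t where "t = n * p"
  have p0: "p > 0" using p(1) by (simp add: prime_gt_0_nat)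
  have t: "t > 0" "coprime t d" using n p p0 by (auto simp: t_def)
  obtain A D where A: "D \<in> den d" "h N = phi (cyc1 t ^ m * A) / phi D"
  proof -
    have "n * p * m \<le> N" using Suc.prems by simp
    hence "vanishes d t m (h N)" unfolding t_def by (rule Suc.IH)
    thus thesis using that unfolding vanishes_def by blast
  qed
  define S where "S = (\<Sum>i<p. xpow n ^ i)"
  have tS: "cyc1 t = cyc1 n * S" unfolding t_def S_def by (rule cyc1_mult)
  have copr: "coprime (cyc1 n ^ i) (S ^ j)" for i j
    using coprime_cyc1_geometric_sum[OF n(1) p0] unfolding S_def by simp
  obtain V where V: "cyc1 n ^ p - cyc1 t = of_nat p * V"
    using prime_dvd_power_pow_diff[OF p(1), of "xpow n" 1]
    unfolding t_def cyc1_def xpow_mult power_one_right by (rule dvdE)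
  have "cyc1 t dvd A"
  proof (rule monic_dvd_padic[OF lead_coeff_cyc1[OF t(1)] p(1)])
    fix j
    define M where "M = N + n * (p * j + m)"
    obtain B D' where B: "D' \<in> den d" "h M = phi (cyc1 t ^ m * B) / phi D'"
    proof -
      have "n * p * m \<le> M" using Suc.prems by (simp add: M_def)
      hence "vanishes d t m (h M)" unfolding t_def by (rule Suc.IH)
      thus thesis using that unfolding vanishes_def by blast
    qed
    obtain C D'' where C: "D'' \<in> den d" "h M = phi (cyc1 n ^ (p * j + m) * C) / phi D''"
    proof -
      have "vanishes d n (p * j + m) (h M)" by (rule IH) (simp add: M_def)
      thus thesis using that unfolding vanishes_def by blast
    qed
    have "(cyc1 t ^ m * B) * D'' = (cyc1 n ^ (p * j + m) * C) * D'"
    proof (rule phi_divide_eq_iff[THEN iffD1])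
      show "D' \<noteq> 0" "D'' \<noteq> 0" using B(1) C(1) d by (auto dest: den_nonzero)
      show "phi (cyc1 t ^ m * B) / phi D' = phi (cyc1 n ^ (p * j + m) * C) / phi D''"
        using B(2) C(2) by (rule trans[OF sym])
    qed
    hence "cyc1 n ^ m * (S ^ m * (B * D'')) = cyc1 n ^ m * (cyc1 n ^ (p * j) * (C * D'))"
      unfolding tS by (simp add: power_mult_distrib power_add mult_ac)
    hence "S ^ m * (B * D'') = cyc1 n ^ (p * j) * (C * D')" using cyc1_nonzero[OF n(1)] by simp
    hence "cyc1 n ^ (p * j) dvd S ^ m * (B * D'')" by simp
    hence "cyc1 n ^ (p * j) dvd B * D''" using copr by (simp add: coprime_dvd_mult_right_iff)
    then obtain G where G: "B * D'' = cyc1 n ^ (p * j) * G" by (rule dvdE)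
    have Vt: "cyc1 n ^ p - of_nat p * V = cyc1 t" using V by (simp only: diff_eq_eq add.commute)
    have 1: "cyc1 t dvd cyc1 n ^ (p * j) - (of_nat p * V) ^ j"
      using diff_dvd_power_diff[of "cyc1 n ^ p" "of_nat p * V" j] unfolding Vt power_mult .
    have 2: "cyc1 t dvd B * D - A * D'"
      by (rule coherent_vanishing_congruence[OF h d t(2,1) _ _ A B])
        (use Suc.prems in \<open>auto simp: M_def t_def\<close>)
    obtain E k where 3: "cyc1 t dvd (D' * D'') * E - [:int d ^ k:]"
      using den_invertible[OF den_mult[OF B(1) C(1)] d t(2,1)] by blast
    have "cyc1 t dvd (cyc1 n ^ (p * j) - (of_nat p * V) ^ j) * (G * D * E)
        - (B * D - A * D') * (D'' * E) - ((D' * D'') * E - [:int d ^ k:]) * A"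
      by (rule dvd_diff[OF dvd_diff[OF dvd_mult2[OF 1] dvd_mult2[OF 2]] dvd_mult2[OF 3]])
    also have "(cyc1 n ^ (p * j) - (of_nat p * V) ^ j) * (G * D * E)
        - (B * D - A * D') * (D'' * E) - ((D' * D'') * E - [:int d ^ k:]) * A =
        (cyc1 n ^ (p * j) * G - B * D'') * (D * E) + ([:int d ^ k:] * A - of_nat p ^ j * (V ^ j * (G * D * E)))"
      by (simp only: ring_distribs power_mult_distrib mult_ac)
    also have "\<dots> = [:int d ^ k:] * A - [:int p ^ j:] * (V ^ j * (G * D * E))"
      by (simp add: G of_nat_poly poly_const_pow)
    finally have "cyc1 t dvd [:int d ^ k:] * A - [:int p ^ j:] * (V ^ j * (G * D * E))" .
    moreover have "\<not> int p dvd int d ^ k"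
    proof
      assume "int p dvd int d ^ k"
      hence "p dvd d ^ k" by (metis int_dvd_int_iff of_nat_power)
      moreover have "coprime p (d ^ k)" using p(2) by simp
      ultimately have "is_unit p" using coprime_common_divisor[of p "d ^ k" p] by simp
      thus False using p(1) by simp
    qed
    ultimately show "\<exists>a g. \<not> int p dvd a \<and> cyc1 t dvd [:a:] * A - [:int p ^ j:] * g" by blast
  qed
  then obtain A' where "A = cyc1 t * A'" by (rule dvdE)
  hence "cyc1 t ^ m * A = cyc1 t ^ Suc m * A'" by simp
  with A show ?case unfolding vanishes_def t_def by metis
qed

lemma vanishes_all:
  assumes h: "coherent d h" and d: "d > 0"
    and one: "\<And>m N. N \<ge> m \<Longrightarrow> vanishes d 1 m (h N)"
    and t: "t > 0" "coprime t d" and N: "N \<ge> t * m"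
  shows "vanishes d t m (h N)"
  using t N
proof (induction t arbitrary: m N rule: less_induct)
  case (less t)
  show ?case
  proof (cases "t = 1")
    case True
    thus ?thesis using one less.prems by simp
  next
    case False
    then obtain p where p: "prime p" "p dvd t" using prime_factor_nat by blast
    then obtain n where n: "t = n * p" by (metis dvdE mult.commute)
    have "n > 0" "n < t" using n less.prems(1) prime_gt_1_nat[OF p(1)] by auto
    moreover have nd: "coprime n d" and pd: "coprime p d" using less.prems(2) by (simp_all add: n)
    ultimately have "vanishes d n m (h N')" if "N' \<ge> n * m" for m N'
      using less.IH[of n m N'] that by simp
    thus ?thesis
      unfolding n using less.prems(3)[unfolded n] vanishes_step[OF h d p(1) pd _ nd] \<open>n > 0\<close> by simp
  qed
qed

lemma coherent_vanishing_in_ideal: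
  assumes h: "coherent d h" and d: "d > 0"
    and van: "\<And>t m N. t > 0 \<Longrightarrow> coprime t d \<Longrightarrow> N \<ge> t * m \<Longrightarrow> vanishes d t m (h N)"
  shows "\<exists>l\<in>fracs d. h N = phi (qpoly d N) * l"
proof -
  have "\<forall>i. \<exists>t W. i > 0 \<longrightarrow> t > 0 \<and> coprime t d \<and> W \<in> den d \<and> cyc1 (d * i) = cyc1 t * W"
    using cyc1_coprime_part d by (metis nat_0_less_mult_iff)
  then obtain t W where tW: "\<And>i. i > 0 \<Longrightarrow> t i > 0" "\<And>i. i > 0 \<Longrightarrow> coprime (t i) d"
    "\<And>i. i > 0 \<Longrightarrow> W i \<in> den d" "\<And>i. i > 0 \<Longrightarrow> cyc1 (d * i) = cyc1 (t i) * W i"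
    by metis
  define T U where "T = prod t {1..N}" and "U = prod W {1..N}"
  have T: "T > 0" "coprime T d"
    using tW(1,2) by (auto simp: T_def intro!: prod_pos prod_coprime_left)
  have U: "U \<in> den d"
  proof -
    have "prod W {1..n} \<in> den d" for n
      by (induction n) (auto intro: den_1 den_mult tW(3))
    thus ?thesis by (simp add: U_def)
  qed
  define M where "M = T * N"
  have "N \<le> M" using T(1) by (simp add: M_def)
  obtain C D where C: "D \<in> den d" "h M = phi (cyc1 T ^ N * C) / phi D"
    using van[OF T, of N M] unfolding vanishes_def M_def by auto
  have "(\<Prod>i\<in>{1..N}. cyc1 (t i)) dvd (\<Prod>i\<in>{1..N}. cyc1 T)"
    unfolding T_def by (intro prod_dvd_prod cyc1_dvd dvd_prodI) simp_all
  hence "(\<Prod>i\<in>{1..N}. cyc1 (t i)) dvd cyc1 T ^ N" by simp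
  then obtain G where G: "cyc1 T ^ N = (\<Prod>i\<in>{1..N}. cyc1 (t i)) * G" by (rule dvdE)
  have "qpoly d N = (\<Prod>i\<in>{1..N}. (-1) * (cyc1 (t i) * W i))"
    unfolding qpoly_def
  proof (rule prod.cong)
    fix i assume "i \<in> {1..N}"
    hence "cyc1 (d * i) = cyc1 (t i) * W i" by (intro tW(4)) simp
    moreover have "1 - xpow (d * i) = (-1) * cyc1 (d * i)" by (simp add: cyc1_def)
    ultimately show "1 - xpow (d * i) = (-1) * (cyc1 (t i) * W i)" by simp
  qed simp
  also have "\<dots> = (-1) ^ N * (\<Prod>i\<in>{1..N}. cyc1 (t i)) * U"
    by (simp only: prod.distrib U_def mult.assoc) simp
  finally have Q: "qpoly d N = (-1) ^ N * (\<Prod>i\<in>{1..N}. cyc1 (t i)) * U" .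
  have nz: "D \<noteq> 0" "U \<noteq> 0" using C(1) U d by (simp_all add: den_nonzero)
  have "h M = phi (qpoly d N) * (phi ((-1) ^ N * G * C) / phi (D * U))"
  proof -
    have "phi (cyc1 T ^ N * C) / phi D = phi (qpoly d N * ((-1) ^ N * G * C)) / phi (D * U)"
    proof (subst phi_divide_eq_iff)
      have sq: "(-1) ^ N * (-1) ^ N = (1 :: int poly)" by (simp flip: power_mult_distrib)
      have "qpoly d N * ((-1) ^ N * G * C) * D = 
        ((-1) ^ N * (-1) ^ N) * (\<Prod>i\<in>{1..N}. cyc1 (t i)) * G * C * D * U"
        unfolding Q by (simp only: mult_ac)
      also have "\<dots> = cyc1 T ^ N * C * (D * U)"
        unfolding sq G by (simp only: mult_ac mult_1_left)
      finally show "cyc1 T ^ N * C * (D * U) = qpoly d N * ((-1) ^ N * G * C) * D" ..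
    qed (use nz in simp_all)
    thus ?thesis unfolding C(2) by simp
  qed
  moreover have "phi ((-1) ^ N * G * C) / phi (D * U) \<in> fracs d"
    using C(1) U by (intro fracsI den_mult)
  ultimately obtain l where l: "l \<in> fracs d" "h M = phi (qpoly d N) * l" by blast
  obtain l' where l': "l' \<in> fracs d" "h M - h N = phi (qpoly d N) * l'"
    using h \<open>N \<le> M\<close> unfolding coherent_def by blast
  have "h N = phi (qpoly d N) * (l - l')" using l(2) l'(2) by (simp add: algebra_simps)
  thus ?thesis using fracs_diff[OF d l(1) l'(1)] by blast
qed

section \<open>The ring \<open>\<Lambda>\<^sub>d\<close> and its ideals\<close>

lemma rat_functions_simps [simp]:
  "carrier rat_functions = UNIV" "monoid.mult rat_functions = (*)" "one rat_functions = 1"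
  "ring.zero rat_functions = 0" "add rat_functions = (+)"
  by (simp_all add: ring_of_type_algebra_def)

lemma a_inv_rat_functions [simp]: "a_inv rat_functions x = - x"
  by (auto simp: a_inv_def m_inv_def add_eq_0_iff)

lemma phi_const: "phi [:a:] = of_int a"
proof -
  have nat: "phi [:int n:] = of_nat n" for n
  proof (induction n)
    case (Suc n)
    have "[:int (Suc n):] = 1 + [:int n:]" by (simp add: one_pCons)
    thus ?case using Suc by (simp only: phi_add phi_1 of_nat_Suc)
  qed simp
  show ?thesis
  proof (cases a)
    case (nonneg n) thus ?thesis by (simp add: nat)
  next
    case (neg n)
    hence "[:a:] = - [:int (Suc n):]" by simp
    thus ?thesis using neg nat[of "Suc n"] by (simp only: phi_uminus) simp
  qed
qed

lemma phi_x: "phi [:0, 1:] = qroot"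
  by (simp add: phi_def qroot_def)

lemma phi_xpow: "phi (xpow n) = qroot ^ n"
proof -
  have "xpow 1 = [:0, 1:]" by (simp add: xpow_def monom_Suc one_pCons)
  thus ?thesis using xpow_mult[of 1 n] by (simp add: phi_x)
qed

lemma qfact_eq: "qfact d n = phi (qpoly d n)"
  by (simp add: qfact_def qpoly_def phi_xpow power_mult)

lemma phi_cyc: "s > 0 \<Longrightarrow> phi (cyc s) = to_fract (cyclotomic s)"
  by (simp add: phi_def cyclotomic_eq)

lemma generate_ring_subset_fracs:
  assumes "d > 0" "H \<subseteq> fracs d"
  shows "generate_ring rat_functions H \<subseteq> fracs d"
proof
  fix x assume "x \<in> generate_ring rat_functions H"
  thus "x \<in> fracs d"
  proof induction
    case one
    show ?case using phi_in_fracs[of 1 d] by simp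
  qed (use assms in \<open>auto simp: fracs_uminus fracs_add fracs_mult\<close>)
qed

lemma A_set_subset_fracs:
  assumes "d > 0"
  shows "A_set d \<subseteq> fracs d"
  unfolding A_set_def
proof (rule generate_ring_subset_fracs[OF assms])
  have "1 / of_nat d \<in> fracs d"
    using fracsI[OF den_const[OF den_1], of 1 d] by (simp add: phi_const)
  moreover have "1 / qroot \<in> fracs d"
    using fracsI[OF den_x[OF den_1], of 1 d] by (simp add: phi_x)
  moreover have "qroot \<in> fracs d"
    using phi_in_fracs[of "[:0, 1:]"] by (simp add: phi_x)
  ultimately show "{1 / of_nat d, qroot, 1 / qroot} \<subseteq> fracs d" by blast
qed

lemma carrier_Lambda:
  assumes "d > 0"
  shows "carrier (Lambda d) = fracs d"
proof -
  define H where "H = A_set d \<union> {1 / to_fract (cyclotomic s) | s. 0 < s \<and> s \<notin> coprime_pos d}"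
  define G where "G = generate_ring rat_functions H"
  have "H \<subseteq> fracs d"
  proof -
    have "1 / to_fract (cyclotomic s) \<in> fracs d" if "0 < s" "s \<notin> coprime_pos d" for s
      using fracsI[OF den_cyc[OF den_1], of s d 1] that by (simp add: coprime_pos_def phi_cyc)
    thus ?thesis using A_set_subset_fracs[OF assms] by (auto simp: H_def)
  qed
  hence "G \<subseteq> fracs d" unfolding G_def by (rule generate_ring_subset_fracs[OF assms])
  have gen: "x \<in> G" if "x \<in> H" for x using that by (simp add: G_def generate_ring.incl)
  have one: "1 \<in> G" using generate_ring.one[of rat_functions H] by (simp add: G_def)
  have add: "x + y \<in> G" if "x \<in> G" "y \<in> G" for x y
    using generate_ring.eng_add[of x rat_functions H y] that by (simp add: G_def)
  have mult: "x * y \<in> G" if "x \<in> G" "y \<in> G" for x y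
    using generate_ring.eng_mult[of x rat_functions H y] that by (simp add: G_def)
  have uminus: "- x \<in> G" if "x \<in> G" for x
    using generate_ring.a_inv[of x rat_functions H] that by (simp add: G_def)
  have zero: "0 \<in> G" using add[OF one uminus[OF one]] by simp
  have base: "1 / of_nat d \<in> G" "qroot \<in> G" "1 / qroot \<in> G"
    by (auto intro!: gen generate_ring.incl simp: H_def A_set_def)
  have of_nat: "of_nat n \<in> G" for n
    by (induction n) (simp_all add: zero one add)
  have of_int: "of_int a \<in> G" for a
    by (cases a) (use of_nat uminus[OF of_nat] in \<open>simp_all del: of_nat_Suc\<close>)
  have phi: "phi P \<in> G" for P
  proof (induction P)
    case 0
    show ?case by (simp add: zero)
  next
    case (pCons a P)
    have "pCons a P = [:a:] + [:0, 1:] * P" by simp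
    hence "phi (pCons a P) = of_int a + qroot * phi P"
      by (simp only: phi_add phi_mult phi_const phi_x)
    thus ?case using of_int base(2) pCons.IH add mult by simp
  qed
  have inv: "1 / phi D \<in> G" if "D \<in> den d" for D
    using that
  proof induction
    case den_1
    show ?case by (simp add: one)
  next
    case (den_const D)
    have "1 / phi ([:int d:] * D) = 1 / of_nat d * (1 / phi D)"
      by (simp only: phi_mult phi_const) simp
    thus ?case using base(1) den_const.IH mult by metis
  next
    case (den_x D)
    have "1 / phi ([:0, 1:] * D) = 1 / qroot * (1 / phi D)"
      by (simp only: phi_mult phi_x) simp
    thus ?case using base(3) den_x.IH mult by metis
  next
    case (den_cyc D s)
    have "1 / phi (cyc s * D) = 1 / to_fract (cyclotomic s) * (1 / phi D)"
      using den_cyc.hyps by (simp add: phi_cyc)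
    moreover have "1 / to_fract (cyclotomic s) \<in> G"
      using den_cyc.hyps by (intro gen) (auto simp: H_def coprime_pos_def)
    ultimately show ?case using den_cyc.IH mult by metis
  qed
  have "fracs d \<subseteq> G"
  proof
    fix x assume "x \<in> fracs d"
    then obtain P D where "D \<in> den d" "x = phi P / phi D" by (auto simp: fracs_def)
    thus "x \<in> G" using mult[OF phi inv, of D P] by simp
  qed
  with \<open>G \<subseteq> fracs d\<close> show ?thesis by (simp add: Lambda_def G_def H_def)
qed

lemma Lambda_simps [simp]: "monoid.mult (Lambda d) = (*)" "add (Lambda d) = (+)"
  by (simp_all add: Lambda_def)

lemma mem_qideal_iff:
  assumes "d > 0"
  shows "x \<in> qideal d n \<longleftrightarrow> (\<exists>l\<in>fracs d. x = phi (qpoly d n) * l)"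
  by (auto simp: qideal_def cgenideal_def carrier_Lambda[OF assms] qfact_eq mult.commute)

lemma qideal_add:
  assumes "d > 0" "x \<in> qideal d n" "y \<in> qideal d n"
  shows "x + y \<in> qideal d n"
proof -
  obtain k l where "k \<in> fracs d" "l \<in> fracs d" "x = phi (qpoly d n) * k" "y = phi (qpoly d n) * l"
    using assms mem_qideal_iff by meson
  moreover from this have "x + y = phi (qpoly d n) * (k + l)" by (simp only: distrib_left)
  ultimately show ?thesis using fracs_add assms(1) mem_qideal_iff by blast
qed

lemma qideal_uminus:
  assumes "d > 0" "x \<in> qideal d n"
  shows "- x \<in> qideal d n"
proof -
  obtain l where "l \<in> fracs d" "x = phi (qpoly d n) * l"
    using assms mem_qideal_iff by meson
  moreover from this have "- x = phi (qpoly d n) * (- l)" by (simp only: mult_minus_right)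
  ultimately show ?thesis using fracs_uminus assms(1) mem_qideal_iff by blast
qed

lemma zero_in_qideal: "d > 0 \<Longrightarrow> 0 \<in> qideal d n"
  using phi_in_fracs[of 0 d] by (force simp: mem_qideal_iff)

lemma Lambda_hat_component:
  assumes d: "d > 0" and f: "f \<in> carrier (Lambda_hat d)"
  shows "\<exists>a\<in>fracs d. \<forall>x. x \<in> f n \<longleftrightarrow> x - a \<in> qideal d n"
proof -
  have "f n \<in> carrier (Lambda d Quot qideal d n)" using f by (simp add: Lambda_hat_def)
  then obtain a where a: "a \<in> fracs d" "f n = (\<Union>h\<in>qideal d n. {h + a})"
    by (auto simp: FactRing_def A_RCOSETS_def' a_r_coset_def' carrier_Lambda[OF d])
  have "x \<in> f n \<longleftrightarrow> x - a \<in> qideal d n" for x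
  proof
    assume "x - a \<in> qideal d n"
    hence "(x - a) + a \<in> f n" unfolding a(2) by blast
    thus "x \<in> f n" by simp
  qed (auto simp: a(2))
  with a(1) show ?thesis by blast
qed

lemma Lambda_hat_transition:
  assumes d: "d > 0" and f: "f \<in> carrier (Lambda_hat d)" and "m \<le> n" "x \<in> f n"
  shows "x \<in> f m"
proof -
  have "f n <+>\<^bsub>Lambda d\<^esub> qideal d m = f m" using f assms(3) by (simp add: Lambda_hat_def)
  moreover have "x + 0 \<in> f n <+>\<^bsub>Lambda d\<^esub> qideal d m"
    unfolding set_add_def' Lambda_simps using assms(4) zero_in_qideal[OF d] by blast
  ultimately show ?thesis by simp
qed

lemma Lambda_hat_nonempty:
  assumes d: "d > 0" and f: "f \<in> carrier (Lambda_hat d)"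
  obtains a where "a \<in> f n"
proof -
  obtain a where "a \<in> fracs d" and a: "\<And>x. x \<in> f n \<longleftrightarrow> x - a \<in> qideal d n"
    using Lambda_hat_component[OF assms, of n] by blast
  have "a \<in> f n" unfolding a using zero_in_qideal[OF d] by simp
  thus thesis by (rule that)
qed

lemma Lambda_hat_diff:
  assumes d: "d > 0" and f: "f \<in> carrier (Lambda_hat d)" and "x \<in> f n" "y \<in> f n"
  shows "x - y \<in> qideal d n"
proof -
  obtain a where "a \<in> fracs d" and a: "\<And>x. x \<in> f n \<longleftrightarrow> x - a \<in> qideal d n"
    using Lambda_hat_component[OF d f, of n] by blast
  have "(x - a) + - (y - a) \<in> qideal d n"
    using assms a by (intro qideal_add qideal_uminus) auto
  thus ?thesis by simp
qed

lemma Lambda_hat_mem_fracs: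
  assumes d: "d > 0" and f: "f \<in> carrier (Lambda_hat d)" and "x \<in> f n"
  shows "x \<in> fracs d"
proof -
  obtain a where a: "a \<in> fracs d" "x - a \<in> qideal d n"
    using Lambda_hat_component[OF d f, of n] assms(3) by blast
  from a(2) obtain l where "l \<in> fracs d" "x - a = phi (qpoly d n) * l"
    using mem_qideal_iff[OF d] by auto
  hence "x - a \<in> fracs d" using fracs_mult[OF phi_in_fracs] by simp
  from fracs_add[OF d this a(1)] show ?thesis by simp
qed

lemma Lambda_hat_component_eqI:
  assumes d: "d > 0" and f: "f \<in> carrier (Lambda_hat d)" and g: "g \<in> carrier (Lambda_hat d)"
    and "x \<in> f n" "y \<in> g n" "x - y \<in> qideal d n"
  shows "f n = g n"
proof -
  have *: "f n \<subseteq> g n"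
    if f: "f \<in> carrier (Lambda_hat d)" and g: "g \<in> carrier (Lambda_hat d)"
      and xy: "x \<in> f n" "y \<in> g n" "x - y \<in> qideal d n" for f g x y
  proof
    fix u assume "u \<in> f n"
    obtain b where "b \<in> fracs d" and b: "\<And>x. x \<in> g n \<longleftrightarrow> x - b \<in> qideal d n"
      using Lambda_hat_component[OF d g, of n] by blast
    have "(u - x) + ((x - y) + (y - b)) \<in> qideal d n"
      using Lambda_hat_diff[OF d f \<open>u \<in> f n\<close> xy(1)] xy b by (intro qideal_add d) auto
    thus "u \<in> g n" by (simp add: b)
  qed
  have "y - x \<in> qideal d n" using qideal_uminus[OF d assms(6)] by simp
  show ?thesis
    by (rule subset_antisym[OF *[OF f g assms(4-6)] *[OF g f assms(5,4) \<open>y - x \<in> qideal d n\<close>]])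
qed


section \<open>Evaluation\<close>

lemma of_rat_poly_mult: "cpoly (p * q) = cpoly p * cpoly q"
  by (intro poly_eqI) (simp add: coeff_map_poly coeff_mult of_rat_sum of_rat_mult)

lemma cpoly_of_int_poly: "cpoly (map_poly of_int p) = map_poly of_int p"
  by (simp add: map_poly_map_poly o_def)

lemma eval_fract_phi:
  assumes "ipoly D z \<noteq> (0 :: complex)"
  shows "eval_fract z (phi P / phi D) = ipoly P z / ipoly D z"
proof -
  define y a b where "y = phi P / phi D" and "a = fst (quot_of_fract y)" and "b = snd (quot_of_fract y)"
  define P' D' :: "rat poly" where "P' = map_poly of_int P" and "D' = map_poly of_int D"
  have D0: "D' \<noteq> 0" using assms by (metis D'_def map_poly_0 of_int_poly_eq_iff poly_0)
  have b0: "b \<noteq> 0" by (simp add: b_def)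
  have "y = to_fract a / to_fract b"
    by (simp add: a_def b_def flip: Fract_conv_to_fract)
  moreover have "y = to_fract P' / to_fract D'" by (simp add: y_def phi_def P'_def D'_def)
  ultimately have "to_fract (a * D') = to_fract (P' * b)"
    using D0 b0 by (simp add: frac_eq_eq)
  hence eq: "a * D' = P' * b" by (simp only: to_fract_eq_iff)
  have "coprime b a" using coprime_quot_of_fract[of y] by (simp add: a_def b_def coprime_commute)
  moreover have "b dvd a * D'" unfolding eq by simp
  ultimately have "b dvd D'" by (simp add: coprime_dvd_mult_right_iff)
  then obtain k where "D' = b * k" by (rule dvdE)
  hence "ipoly D z = poly (cpoly b) z * poly (cpoly k) z"
    by (metis D'_def cpoly_of_int_poly of_rat_poly_mult poly_mult)
  hence "poly (cpoly b) z \<noteq> 0" using assms by auto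
  moreover have "poly (cpoly a) z * ipoly D z = ipoly P z * poly (cpoly b) z"
    using eq by (metis D'_def P'_def cpoly_of_int_poly of_rat_poly_mult poly_mult)
  ultimately show ?thesis
    using assms unfolding eval_fract_def a_def [symmetric] b_def [symmetric] y_def [symmetric]
    by (simp add: frac_eq_eq)
qed

lemma ipoly_den_nonzero:
  assumes "D \<in> den d" "d > 0" "r > 0" "coprime r d" "z ^ r = (1 :: complex)"
  shows "ipoly D z \<noteq> 0"
proof
  assume D: "ipoly D z = 0"
  obtain E k where "cyc1 r dvd D * E - [:int d ^ k:]"
    using den_invertible[OF assms(1,2,4,3)] by blast
  then obtain q where "D * E - [:int d ^ k:] = cyc1 r * q" by (rule dvdE)
  hence "ipoly (D * E - [:int d ^ k:]) z = ipoly (cyc1 r * q) z" by simp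
  hence "of_nat d ^ k = (0 :: complex)"
    using D assms(5) by (simp only: of_int_poly_diff of_int_poly_mult poly_diff poly_mult) simp
  thus False using assms(2) by simp
qed

lemma eval_fract_cong_qideal:
  assumes d: "d > 0" and r: "r > 0" "coprime r d" "z ^ r = 1" and n: "n \<ge> r"
    and x: "x \<in> fracs d" and xy: "x - y \<in> qideal d n"
  shows "eval_fract z x = eval_fract z y"
proof -
  obtain l where l: "l \<in> fracs d" "x - y = phi (qpoly d n) * l"
    using xy mem_qideal_iff[OF d] by auto
  obtain P D Q E where P: "x = phi P / phi D" "D \<in> den d" and Q: "l = phi Q / phi E" "E \<in> den d"
    using x l(1) by (auto simp: fracs_def)
  have nz: "D \<noteq> 0" "E \<noteq> 0" "ipoly D z \<noteq> 0" "ipoly E z \<noteq> 0"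
    using P Q d r ipoly_den_nonzero[of _ d r z] by (auto dest: den_nonzero)
  have "y = phi P / phi D - phi (qpoly d n) * (phi Q / phi E)"
    using l(2) unfolding P(1) Q(1) by (simp add: algebra_simps)
  also have "\<dots> = phi (P * E - qpoly d n * Q * D) / phi (D * E)"
    using nz(1,2) by (simp add: field_simps)
  finally have y: "y = phi (P * E - qpoly d n * Q * D) / phi (D * E)" .
  have "ipoly (qpoly d n) z = 0"
  proof -
    have "z ^ (d * r) = 1" using power_mult[of z r d] r(3) by (simp add: mult.commute)
    hence "ipoly (1 - xpow (d * r)) z = 0" by simp
    moreover have "1 - xpow (d * r) dvd qpoly d n"
      unfolding qpoly_def using r(1) n by (intro dvd_prodI) auto
    ultimately show ?thesis by auto
  qed
  hence "eval_fract z y = ipoly P z / ipoly D z"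
    unfolding y using nz by (subst eval_fract_phi) simp_all
  also have "\<dots> = eval_fract z x" unfolding P(1) using nz by (subst eval_fract_phi) simp_all
  finally show ?thesis by simp
qed

lemma root_exponent:
  assumes "\<xi> \<in> U_set d"
  defines "z \<equiv> \<xi> powi root_exponent d \<xi>"
  shows power_root_exponent: "z ^ root_order \<xi> = 1"
    and root_exponent_in_roots_of_unity: "z \<in> roots_of_unity"
    and root_order_root_exponent: "root_order z = root_order \<xi>"
proof -
  define r where "r = root_order \<xi>"
  have \<xi>: "\<xi> \<in> roots_of_unity" "coprime r d" using assms(1) by (auto simp: U_set_def r_def)
  have r: "r > 0" "\<xi> ^ r = 1" using root_order_pos power_root_order \<xi>(1) by (auto simp: r_def)
  have red: "\<xi> ^ n = \<xi> ^ (n mod r)" for n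
  proof -
    have "\<xi> ^ n = (\<xi> ^ r) ^ (n div r) * \<xi> ^ (n mod r)"
      by (simp only: power_mult [symmetric] power_add [symmetric] mult_div_mod_eq)
    thus ?thesis by (simp add: r(2))
  qed
  obtain b where "[d * b = 1] (mod r)"
    using cong_solve_coprime_nat[of d r] \<xi>(2) by (auto simp: coprime_commute)
  hence "\<xi> ^ (d * b) = \<xi> ^ 1" using red[of "d * b"] red[of 1] by (simp add: cong_def)
  hence "(\<xi> powi int b) ^ d = \<xi>" by (simp add: mult.commute flip: power_mult)
  hence zd: "z ^ d = \<xi>" unfolding z_def root_exponent_def by (rule someI)
  have "z ^ r = (\<xi> ^ r) powi root_exponent d \<xi>"
    unfolding z_def by (simp add: power_int_power power_int_power' mult.commute)
  thus zr: "z ^ root_order \<xi> = 1" by (simp add: r_def [symmetric] r(2))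
  thus "z \<in> roots_of_unity" using r(1) by (auto simp: roots_of_unity_def r_def)
  show "root_order z = root_order \<xi>"
  proof (rule root_orderI[OF zr])
    show "root_order \<xi> > 0" using r(1) by (simp add: r_def)
    fix m :: nat assume m: "m > 0" "z ^ m = 1"
    have "\<xi> ^ m = (z ^ m) ^ d" by (simp add: mult.commute flip: zd power_mult)
    hence "root_order \<xi> dvd m" using m(2) power_eq_1_iff_root_order[OF \<xi>(1)] by simp
    thus "root_order \<xi> \<le> m" using m(1) by (rule dvd_imp_le)
  qed
qed

lemma ev_hat_eq:
  assumes d: "d > 0" and f: "f \<in> carrier (Lambda_hat d)" and \<xi>: "\<xi> \<in> U_set d"
    and n: "n \<ge> root_order \<xi>" and x: "x \<in> f n"
  shows "ev_hat d \<xi> f = ev d \<xi> x"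
  unfolding ev_hat_def
proof (rule the_equality)
  define r where "r = root_order \<xi>"
  have r: "r > 0" "coprime r d" using \<xi> root_order_pos by (auto simp: U_set_def r_def)
  have "ev d \<xi> y = ev d \<xi> x" if "m \<ge> r" "y \<in> f m" for y m
  proof -
    have "x \<in> f r" "y \<in> f r" using Lambda_hat_transition[OF d f] n x that by (auto simp: r_def)
    thus ?thesis
      unfolding ev_def
      using eval_fract_cong_qideal[OF d r _ order_refl] power_root_exponent[OF \<xi>]
        Lambda_hat_mem_fracs[OF d f] Lambda_hat_diff[OF d f]
      by (simp add: r_def)
  qed
  thus *: "\<forall>m\<ge>root_order \<xi>. \<forall>y\<in>f m. ev d \<xi> y = ev d \<xi> x" by (simp add: r_def)
  fix c assume "\<forall>m\<ge>root_order \<xi>. \<forall>y\<in>f m. ev d \<xi> y = c"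
  thus "c = ev d \<xi> x" using n x by metis
qed

lemma ev_diff_eq_0:
  assumes d: "d > 0" and \<xi>: "\<xi> \<in> U_set d" and xy: "x \<in> fracs d" "y \<in> fracs d"
    and ev: "ev d \<xi> x = ev d \<xi> y" and P: "D \<in> den d" "x - y = phi P / phi D"
  shows "ipoly P (\<xi> powi root_exponent d \<xi>) = 0"
proof -
  define z where "z = \<xi> powi root_exponent d \<xi>"
  have "root_order \<xi> > 0" "coprime (root_order \<xi>) d"
    using \<xi> root_order_pos by (auto simp: U_set_def)
  hence nz: "ipoly E z \<noteq> 0" if "E \<in> den d" for E
    using ipoly_den_nonzero[OF that d] power_root_exponent[OF \<xi>] by (simp add: z_def)
  obtain A E B F where A: "x = phi A / phi E" "E \<in> den d" and B: "y = phi B / phi F" "F \<in> den d"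
    using xy by (auto simp: fracs_def)
  have *: "ipoly A z * ipoly F z = ipoly B z * ipoly E z"
    using ev nz A(2) B(2) unfolding ev_def z_def [symmetric] A(1) B(1)
    by (simp add: eval_fract_phi frac_eq_eq)
  have "D \<noteq> 0" "E \<noteq> 0" "F \<noteq> 0" using P A B d by (auto dest: den_nonzero)
  moreover have "x - y = phi (A * F - B * E) / phi (E * F)"
    using \<open>E \<noteq> 0\<close> \<open>F \<noteq> 0\<close> by (simp add: A B diff_frac_eq)
  ultimately have "P * (E * F) = (A * F - B * E) * D"
    using P(2) by (simp only: phi_divide_eq_iff no_zero_divisors not_False_eq_True)
  hence "ipoly (P * (E * F)) z = ipoly ((A * F - B * E) * D) z" by simp
  hence "ipoly P z * (ipoly E z * ipoly F z) = 0"
    using * by simp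
  thus ?thesis using nz A(2) B(2) by (simp add: z_def)
qed

theorem theorem4:
  fixes d :: nat and \<Omega> :: "complex set"
  assumes "d > 0"
    and "\<Omega> \<subseteq> U_set d"
    and "infinite {\<xi> \<in> \<Omega>. primepow (root_order \<xi>)}"
  shows "(\<forall>f \<in> carrier (Lambda_hat d). \<forall>g \<in> carrier (Lambda_hat d).
            (\<forall>\<xi> \<in> \<Omega>. ev_hat d \<xi> f = ev_hat d \<xi> g) \<longrightarrow> f = g) \<and>
         inj_on (ev_family d \<Omega>) (carrier (Lambda_hat d))"
proof -
  note d = assms(1)
  define V where "V = {\<xi> \<in> \<Omega>. primepow (root_order \<xi>)}"
  have VU: "\<xi> \<in> U_set d" if "\<xi> \<in> V" for \<xi> using that assms(2) by (auto simp: V_def)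
  have inf: "infinite (root_order ` V)"
  proof
    assume fin: "finite (root_order ` V)"
    have "finite {\<xi> \<in> V. root_order \<xi> = s}" if "s \<in> root_order ` V" for s
    proof (rule finite_subset)
      show "{\<xi> \<in> V. root_order \<xi> = s} \<subseteq> primitive_roots s"
        using VU by (auto simp: primitive_roots_def U_set_def)
      show "finite (primitive_roots s)"
        using that VU by (intro finite_primitive_roots) (auto simp: U_set_def root_order_pos)
    qed
    hence "finite (\<Union>s\<in>root_order ` V. {\<xi> \<in> V. root_order \<xi> = s})" using fin by blast
    moreover have "V \<subseteq> (\<Union>s\<in>root_order ` V. {\<xi> \<in> V. root_order \<xi> = s})" by blast
    ultimately have "finite V" by (rule finite_subset[rotated])
    thus False using assms(3) by (simp add: V_def)
  qed
  obtain V' where V': "V' \<subseteq> V" "inj_on root_order V'" "root_order ` V = root_order ` V'"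
    using subset_image_inj[of "root_order ` V" root_order V] by auto
  define Z where "Z \<xi> = \<xi> powi root_exponent d \<xi>" for \<xi>
  have order_Z: "root_order (Z \<xi>) = root_order \<xi>" if "\<xi> \<in> V'" for \<xi>
    using root_order_root_exponent[of \<xi> d] VU V'(1) that by (auto simp: Z_def)
  define W where "W = Z ` V'"
  have "root_order ` W = root_order ` V" unfolding V'(3) W_def image_image
    using order_Z by (rule image_cong[OF refl])
  hence W_inf: "infinite W" using inf by (metis finite_imageI)
  have W_inj: "inj_on root_order W"
    using V'(2) order_Z by (auto simp: W_def inj_on_def)
  have W: "z \<in> roots_of_unity \<and> primepow (root_order z) \<and> coprime (root_order z) d" if z: "z \<in> W" for z
  proof -
    obtain \<xi> where \<xi>: "\<xi> \<in> V'" "z = Z \<xi>" using z by (auto simp: W_def)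
    hence "\<xi> \<in> V" "\<xi> \<in> U_set d" using V'(1) VU by auto
    thus ?thesis
      using order_Z[OF \<xi>(1)] root_exponent_in_roots_of_unity[of \<xi> d]
      by (auto simp: \<xi>(2) Z_def V_def U_set_def)
  qed
  have main: "f = g" if f: "f \<in> carrier (Lambda_hat d)" and g: "g \<in> carrier (Lambda_hat d)"
    and eq: "\<And>\<xi>. \<xi> \<in> \<Omega> \<Longrightarrow> ev_hat d \<xi> f = ev_hat d \<xi> g" for f g
  proof -
    have "\<forall>n. \<exists>x. x \<in> f n" "\<forall>n. \<exists>x. x \<in> g n"
      using Lambda_hat_nonempty[OF d f] Lambda_hat_nonempty[OF d g] by metis+
    then obtain a b where a: "\<And>n. a n \<in> f n" and b: "\<And>n. b n \<in> g n" by metis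
    have ab: "a n \<in> fracs d" "b n \<in> fracs d" for n
      using a b Lambda_hat_mem_fracs[OF d] f g by blast+
    define h where "h n = a n - b n" for n
    have h: "coherent d h"
      unfolding coherent_def
    proof (intro conjI allI impI)
      show "h n \<in> fracs d" for n unfolding h_def by (intro fracs_diff d ab)
      fix m n :: nat assume "m \<le> n"
      hence "a n \<in> f m" "b n \<in> g m"
        using Lambda_hat_transition[OF d f] Lambda_hat_transition[OF d g] a b by blast+
      hence "(a n - a m) + - (b n - b m) \<in> qideal d m"
        using a b by (intro qideal_add qideal_uminus Lambda_hat_diff[OF d f] Lambda_hat_diff[OF d g] d)
      thus "\<exists>l\<in>fracs d. h n - h m = phi (qpoly d m) * l"
        by (simp add: mem_qideal_iff[OF d] h_def algebra_simps)
    qed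
    have zero: "ipoly P z = 0"
      if z: "z \<in> W" and N: "N \<ge> root_order z" and P: "D \<in> den d" "h N = phi P / phi D" for z N P D
    proof -
      obtain \<xi> where \<xi>: "\<xi> \<in> V'" "z = Z \<xi>" using z by (auto simp: W_def)
      hence U: "\<xi> \<in> U_set d" "\<xi> \<in> \<Omega>" using V'(1) VU by (auto simp: V_def)
      have "N \<ge> root_order \<xi>" using N order_Z \<xi> by simp
      hence "ev d \<xi> (a N) = ev d \<xi> (b N)"
        using ev_hat_eq[OF d f U(1) _ a] ev_hat_eq[OF d g U(1) _ b] eq[OF U(2)] by metis
      thus ?thesis
        using ev_diff_eq_0[OF d U(1) ab _ P(1)] P(2) by (simp add: h_def \<xi>(2) Z_def)
    qed
    have one: "vanishes d 1 m (h N)" if "N \<ge> m" for m N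
      using W zero that by (rule vanishes_at_1[OF h d W_inf W_inj])
    have "vanishes d t m (h N)" if "t > 0" "coprime t d" "N \<ge> t * m" for t m N
      using one that by (rule vanishes_all[OF h d])
    hence "\<exists>l\<in>fracs d. h n = phi (qpoly d n) * l" for n
      by (rule coherent_vanishing_in_ideal[OF h d])
    hence "a n - b n \<in> qideal d n" for n by (simp add: mem_qideal_iff[OF d] h_def)
    hence "f n = g n" for n using Lambda_hat_component_eqI[OF d f g a b] by blast
    thus ?thesis by (rule ext)
  qed
  moreover have "inj_on (ev_family d \<Omega>) (carrier (Lambda_hat d))"
  proof (rule inj_onI)
    fix f g assume f: "f \<in> carrier (Lambda_hat d)" and g: "g \<in> carrier (Lambda_hat d)"
      and "ev_family d \<Omega> f = ev_family d \<Omega> g"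
    hence "ev_hat d \<xi> f = ev_hat d \<xi> g" if "\<xi> \<in> \<Omega>" for \<xi>
      using that unfolding ev_family_def by (metis restrict_apply')
    with f g show "f = g" by (rule main)
  qed
  ultimately show ?thesis by blast
qed

end
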